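(* Let $G=(V,E)$ be a directed feedback graph with $|V|\ge 2$, fixed and known to the player in advance. Let $\alpha=\alpha(G)$ be its independence number and $\delta=\delta(G)$ its weak domination number. Then, for $T\ge |V|^3$, the minimax regret $R(G,T)$ of the $T$-round online learning problem with feedback graph $G$ satisfies: (i) $R(G,T)=\tilde\Theta(\alpha^{1/2}T^{1/2})$ if $G$ is strongly observable; (ii) $R(G,T)=\tilde\Theta(\delta^{1/3}T^{2/3})$ if $G$ is weakly observable; (iii) $R(G,T)=\Theta(T)$ if $G$ is not observable.
   Context: Let $G=(V,E)$ be a directed graph (self-loops $(i,i)$ allowed) on the action set $V=\{1,\dots,K\}$. For $i\in V$ let $N^{\mathrm{in}}(i)=\{j\in V:(j,i)\in E\}$ and $N^{\mathrm{out}}(i)=\{j\in V:(i,j)\in E\}$. Online learning with feedback graph $G$: before the game the environment fixes loss functions $\ell_1,\ell_2,\dots$ with $\ell_t:V\to[0,1]$. On each round $t$ the player randomly chooses an action $I_t\in V$ (depending on past observations), incurs loss $\ell_t(I_t)$, and at the end of the round observes only $\{(j,\ell_t(j)):j\in N^{\mathrm{out}}(I_t)\}$ (in particular, it does not observe its own loss unless $I_t$ has a self-loop). The expected regret against $\ell_1,\dots,\ell_T$ is $\mathbb{E}[\sum_{t=1}^T\ell_t(I_t)]-\min_{i\in V}\sum_{t=1}^T\ell_t(i)$. The minimax regret $R(G,T)$ is the infimum over all randomized player strategies of the supremum over all loss sequences $\ell_1,\dots,\ell_T$ of the expected regret. A vertex $i$ is observable if $N^{\mathrm{in}}(i)\neq\emptyset$;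 strongly observable if $\{i\}\subseteq N^{\mathrm{in}}(i)$ or $V\setminus\{i\}\subseteq N^{\mathrm{in}}(i)$ (or both); weakly observable if observable but not strongly observable. $G$ is observable if all vertices are observable, strongly observable if all vertices are strongly observable, and weakly observable if it is observable but not strongly observable. If $W$ is the set of weakly observable vertices, a weakly dominating set is a set $D\subseteq V$ such that for every $w\in W$ there is $d\in D$ with $w\in N^{\mathrm{out}}(d)$; the weak domination number $\delta(G)$ is the size of a smallest weakly dominating set. An independent set is $S\subseteq V$ such that $(u,v)\notin E$ for all distinct $u,v\in S$; $\alpha(G)$ is the size of a largest independent set. $\tilde\Theta$ denotes equality up to constant factors and factors logarithmic in $K$ and $T$. *)

theory Defs
  imports "HOL-Probability.Probability"
begin

text \<open>Feedback graph: actions V = {..<K} (i.e. 0,...,K-1), edge set E \<subseteq> V \<times> V,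
  self-loops allowed.\<close>

definition in_nbrs :: "(nat \<times> nat) set \<Rightarrow> nat \<Rightarrow> nat set" where
  "in_nbrs E i = {j. (j, i) \<in> E}"

definition out_nbrs :: "(nat \<times> nat) set \<Rightarrow> nat \<Rightarrow> nat set" where
  "out_nbrs E i = {j. (i, j) \<in> E}"

definition observable_vertex :: "nat \<Rightarrow> (nat \<times> nat) set \<Rightarrow> nat \<Rightarrow> bool" where
  "observable_vertex K E i \<longleftrightarrow> in_nbrs E i \<inter> {..<K} \<noteq> {}"

definition strongly_observable_vertex :: "nat \<Rightarrow> (nat \<times> nat) set \<Rightarrow> nat \<Rightarrow> bool" where
  "strongly_observable_vertex K E i \<longleftrightarrow>
     {i} \<subseteq> in_nbrs E i \<or> {..<K} - {i} \<subseteq> in_nbrs E i"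

definition weakly_observable_vertex :: "nat \<Rightarrow> (nat \<times> nat) set \<Rightarrow> nat \<Rightarrow> bool" where
  "weakly_observable_vertex K E i \<longleftrightarrow>
     observable_vertex K E i \<and> \<not> strongly_observable_vertex K E i"

definition observable_graph :: "nat \<Rightarrow> (nat \<times> nat) set \<Rightarrow> bool" where
  "observable_graph K E \<longleftrightarrow> (\<forall>i<K. observable_vertex K E i)"

definition strongly_observable_graph :: "nat \<Rightarrow> (nat \<times> nat) set \<Rightarrow> bool" where
  "strongly_observable_graph K E \<longleftrightarrow> (\<forall>i<K. strongly_observable_vertex K E i)"

definition weakly_observable_graph :: "nat \<Rightarrow> (nat \<times> nat) set \<Rightarrow> bool" where
  "weakly_observable_graph K E \<longleftrightarrow> observable_graph K E \<and> \<not> strongly_observable_graph K E"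

definition independent_set :: "(nat \<times> nat) set \<Rightarrow> nat set \<Rightarrow> bool" where
  "independent_set E S \<longleftrightarrow> (\<forall>u\<in>S. \<forall>v\<in>S. u \<noteq> v \<longrightarrow> (u, v) \<notin> E)"

definition independence_number :: "nat \<Rightarrow> (nat \<times> nat) set \<Rightarrow> nat" where
  "independence_number K E = Max (card ` {S. S \<subseteq> {..<K} \<and> independent_set E S})"

definition weakly_dominating_set :: "nat \<Rightarrow> (nat \<times> nat) set \<Rightarrow> nat set \<Rightarrow> bool" where
  "weakly_dominating_set K E D \<longleftrightarrow> D \<subseteq> {..<K} \<and>
     (\<forall>w<K. weakly_observable_vertex K E w \<longrightarrow> (\<exists>d\<in>D. w \<in> out_nbrs E d))"

definition weak_domination_number :: "nat \<Rightarrow> (nat \<times> nat) set \<Rightarrow> nat" where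
  "weak_domination_number K E = Min (card ` {D. weakly_dominating_set K E D})"

text \<open>The game. Rounds are indexed 0,...,T-1. A loss sequence is l :: nat => nat => real,
  l t i = loss of action i at round t. After playing action i at round t the player observes
  the partial function j |-> l t j for j in N_out(i) (None elsewhere). A history is the list
  of (own action, observation) pairs; a randomized player strategy maps each history to a
  distribution over the next action.\<close>

type_synonym history = "(nat \<times> (nat \<Rightarrow> real option)) list"
type_synonym strategy = "history \<Rightarrow> nat pmf"

definition observation :: "(nat \<times> nat) set \<Rightarrow> (nat \<Rightarrow> nat \<Rightarrow> real) \<Rightarrow> nat \<Rightarrow> nat \<Rightarrow> (nat \<Rightarrow> real option)" where
  "observation E l t i = (\<lambda>j. if (i, j) \<in> E then Some (l t j) else None)"

fun history_dist :: "(nat \<times> nat) set \<Rightarrow> strategy \<Rightarrow> (nat \<Rightarrow> nat \<Rightarrow> real) \<Rightarrow> nat \<Rightarrow> history pmf" where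
  "history_dist E s l 0 = return_pmf []"
| "history_dist E s l (Suc t) =
     bind_pmf (history_dist E s l t) (\<lambda>h.
       bind_pmf (s h) (\<lambda>i. return_pmf (h @ [(i, observation E l t i)])))"

definition valid_strategy :: "nat \<Rightarrow> strategy \<Rightarrow> bool" where
  "valid_strategy K s \<longleftrightarrow> (\<forall>h. set_pmf (s h) \<subseteq> {..<K})"

definition valid_losses :: "(nat \<Rightarrow> nat \<Rightarrow> real) \<Rightarrow> bool" where
  "valid_losses l \<longleftrightarrow> (\<forall>t i. 0 \<le> l t i \<and> l t i \<le> 1)"

definition expected_regret ::
  "nat \<Rightarrow> (nat \<times> nat) set \<Rightarrow> strategy \<Rightarrow> (nat \<Rightarrow> nat \<Rightarrow> real) \<Rightarrow> nat \<Rightarrow> real" where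
  "expected_regret K E s l T =
     measure_pmf.expectation (history_dist E s l T) (\<lambda>h. \<Sum>t<T. l t (fst (h ! t)))
     - Min ((\<lambda>i. \<Sum>t<T. l t i) ` {..<K})"

definition minimax_regret :: "nat \<Rightarrow> (nat \<times> nat) set \<Rightarrow> nat \<Rightarrow> real" where
  "minimax_regret K E T =
     (INF s \<in> {s. valid_strategy K s}. SUP l \<in> {l. valid_losses l}. expected_regret K E s l T)"

end

theory Submission
  imports Defs
begin

text \<open>
  Upper bounds: exponential weights with importance-weighted loss estimates, mixed with
  exploration of all actions (strongly observable case) or of a weakly dominating set together
  with two arbitrary actions (weakly observable case). The regret is governed by the sum of
  \<open>q j / P j\<close>, where \<open>P j\<close> is the probability of observing \<open>j\<close>. On actions with self-loops this
  sum is \<open>O(\<alpha> log (K T))\<close> by a weighted Turan argument.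

  Lower bounds: all actions of a suitable set \<open>U\<close> get fair coin losses, one hidden action of \<open>U\<close>
  gets bias \<open>1/2 - \<epsilon>\<close>, and all other actions lose 1. Telling the coins apart needs about
  \<open>1/\<epsilon>\<^sup>2\<close> observations of the hidden action. For strongly observable graphs \<open>U\<close> is a maximum
  independent set; the assumption \<open>T \<ge> K^3\<close> makes exploration outside \<open>U\<close> too expensive. For
  weakly observable graphs \<open>U\<close> is an independent set of at least \<open>\<delta>\<close> over a power of \<open>log (K T)\<close>
  weakly observable vertices of which every vertex dominates only \<open>O(log (K T))\<close>, so that
  information on \<open>U\<close> has to be bought outside \<open>U\<close>.
\<close>

text \<open>What the player spends on observations is bounded only by the player's own regret, so
  the lower bounds start from an arbitrary upper bound \<open>R\<close> on the regret of a strategy: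
  either \<open>R\<close> is already large, or too few observations were bought to tell the coins
  apart. With \<open>m\<close> coins and free observations in every round,
  \<open>m / \<epsilon>^2 ~ T\<close> gives the rate \<open>sqrt (m T)\<close>; if a unit of regret
  buys about \<open>d\<close> observations, \<open>m / \<epsilon>^2 ~ d \<epsilon> T\<close> gives
  \<open>(m / d)^(1/3) T^(2/3)\<close>. Hence the need for small \<open>d\<close> in the weakly
  observable case: a vertex that sees many coins at once would make exploration cheap. Thin sets
  cost logarithms and may shrink to one vertex when \<delta> is small; a two-action game covers that
  range. In the weakly observable upper bound, \<open>K^3 \<le> T\<close> also keeps the
  contribution of the loops, of order \<open>K\<close>, below the main term.\<close>

section \<open>Independent sets and thinly dominated sets\<close>

text \<open>Double counting: the \<open>p\<close>-averages of closed out-weights and closed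
  in-weights agree, so some \<open>v\<close> has out-weight at most \<beta> as well. Put
  \<open>v\<close> into \<open>S\<close>, delete its in- and out-neighbours (weight at most
  \<open>2 * \<beta>\<close>) and recurse.\<close>

lemma weighted_turan:
  fixes p :: "nat \<Rightarrow> real"
  assumes "finite U" "\<And>v. v \<in> U \<Longrightarrow> 0 < p v"
    and "\<And>v. v \<in> U \<Longrightarrow> sum p {j\<in>U. (j, v) \<in> E \<or> j = v} \<le> \<beta>"
  shows "\<exists>S\<subseteq>U. independent_set E S \<and> sum p U \<le> 2 * \<beta> * card S"
  using assms
proof (induction U rule: finite_psubset_induct)
  case (psubset U)
  note fin = \<open>finite U\<close> and pos = psubset.prems(1) and inw = psubset.prems(2)
  define I where "I v = {j\<in>U. (j, v) \<in> E \<or> j = v}" for v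
  define O' where "O' v = {j\<in>U. (v, j) \<in> E \<or> j = v}" for v
  show ?case
  proof (cases "U = {}")
    case True
    then show ?thesis by (auto simp: independent_set_def)
  next
    case False
    have "\<exists>v\<in>U. sum p (O' v) \<le> \<beta>"
    proof (rule ccontr)
      assume "\<not> ?thesis"
      then have *: "\<And>v. v \<in> U \<Longrightarrow> \<beta> < sum p (O' v)" by auto
      have "\<beta> * sum p U = (\<Sum>v\<in>U. p v * \<beta>)"
        by (simp add: sum_distrib_left mult.commute)
      also have "\<dots> < (\<Sum>v\<in>U. p v * sum p (O' v))"
        using * pos fin False by (intro sum_strict_mono) auto
      also have "\<dots> = (\<Sum>v\<in>U. \<Sum>j\<in>U. if (v, j) \<in> E \<or> j = v then p v * p j else 0)"
        using fin by (simp add: O'_def sum_distrib_left flip: sum.inter_filter)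
      also have "\<dots> = (\<Sum>j\<in>U. \<Sum>v\<in>U. if (v, j) \<in> E \<or> j = v then p v * p j else 0)"
        by (rule sum.swap)
      also have "\<dots> = (\<Sum>j\<in>U. p j * sum p (I j))"
        using fin by (simp add: I_def sum_distrib_left mult.commute eq_commute flip: sum.inter_filter)
      also have "\<dots> \<le> (\<Sum>j\<in>U. p j * \<beta>)"
        using inw pos by (intro sum_mono mult_left_mono) (auto simp: I_def less_imp_le)
      also have "\<dots> = \<beta> * sum p U"
        by (simp add: sum_distrib_left mult.commute)
      finally show False by simp
    qed
    then obtain v where v: "v \<in> U" "sum p (O' v) \<le> \<beta>" by auto
    define U' where "U' = U - (I v \<union> O' v)"
    have "U' \<subset> U" using v by (auto simp: U'_def I_def)
    have "sum p {j\<in>U'. (j, u) \<in> E \<or> j = u} \<le> \<beta>" if "u \<in> U'" for u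
    proof -
      have "sum p {j\<in>U'. (j, u) \<in> E \<or> j = u} \<le> sum p {j\<in>U. (j, u) \<in> E \<or> j = u}"
        using fin pos by (intro sum_mono2) (auto simp: U'_def less_imp_le)
      then show ?thesis using inw[of u] that by (auto simp: U'_def)
    qed
    then obtain S where S: "S \<subseteq> U'" "independent_set E S" "sum p U' \<le> 2 * \<beta> * card S"
      using psubset.IH[OF \<open>U' \<subset> U\<close>] pos by (auto simp: U'_def)
    have vS: "v \<notin> S" using S(1) by (auto simp: U'_def I_def v)
    have finS: "finite S" using S(1) fin by (auto simp: U'_def intro: finite_subset)
    have "independent_set E (insert v S)"
      using S(1,2) by (auto simp: independent_set_def U'_def I_def O'_def)
    moreover have "sum p U \<le> 2 * \<beta> * card (insert v S)"
    proof -
      have "sum p U = sum p U' + sum p (I v \<union> O' v)"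
        unfolding U'_def using fin by (intro sum.subset_diff) (auto simp: I_def O'_def)
      also have "sum p (I v \<union> O' v) \<le> sum p (I v) + sum p (O' v)"
        using fin sum_nonneg[of "I v \<inter> O' v" p] less_imp_le[OF pos]
        by (subst sum_Un) (auto simp: I_def O'_def)
      finally show ?thesis
        using S(3) v(2) inw[OF v(1)] vS finS by (auto simp: I_def algebra_simps)
    qed
    ultimately show ?thesis using S(1) v(1) \<open>U' \<subset> U\<close> by (intro exI[of _ "insert v S"]) auto
  qed
qed

text \<open>Remove the vertex \<open>v\<close> of largest closed in-weight.
  \<open>weighted_turan\<close> with that in-weight as \<beta> bounds its ratio by
  \<open>2 * a * (p v / sum p U)\<close>, and \<open>p v / sum p U\<close> is at most the drop of
  \<open>ln (sum p U)\<close> when \<open>v\<close> leaves, so the bounds telescope. The other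
  ratios only grow when \<open>U\<close> shrinks. The summand 1 pays for the last vertex.\<close>

lemma sum_weight_ratio_le:
  fixes p :: "nat \<Rightarrow> real"
  assumes "finite U" "U \<noteq> {}" "0 < \<epsilon>" "\<And>v. v \<in> U \<Longrightarrow> \<epsilon> \<le> p v"
    and "\<And>S. S \<subseteq> U \<Longrightarrow> independent_set E S \<Longrightarrow> card S \<le> a"
  shows "(\<Sum>v\<in>U. p v / sum p {j\<in>U. (j, v) \<in> E \<or> j = v}) \<le> 2 * a * (1 + ln (sum p U / \<epsilon>))"
  using assms
proof (induction U rule: finite_psubset_induct)
  case (psubset U)
  note fin = \<open>finite U\<close> and eps = psubset.prems(2,3) and ne = psubset.prems(1)
  define P where "P X v = sum p {j\<in>X. (j, v) \<in> E \<or> j = v}" for X v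
  have pos: "0 < p v" if "v \<in> U" for v using eps that by force
  have "Max (P U ` U) \<in> P U ` U" using fin ne by simp
  then obtain v where "v \<in> U" "Max (P U ` U) = P U v" by auto
  then have v: "v \<in> U" "\<And>u. u \<in> U \<Longrightarrow> P U u \<le> P U v"
    using fin by (auto simp flip: \<open>Max (P U ` U) = P U v\<close>)
  obtain S where S: "S \<subseteq> U" "independent_set E S" "sum p U \<le> 2 * P U v * card S"
    using weighted_turan[where U=U and p=p and E=E and \<beta>="P U v"] fin pos v(2) by (auto simp: P_def)
  have Ppos: "0 < P X u" if "X \<subseteq> U" "u \<in> X" for u X
    unfolding P_def using that fin pos by (intro sum_pos) (auto intro: finite_subset)
  have sumpos: "0 < sum p U" using fin ne pos by (intro sum_pos) auto
  have "sum p U \<le> 2 * P U v * a"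
    using psubset.prems(4)[OF S(1,2)] Ppos[of U v] v(1)
    by (intro order.trans[OF S(3)] mult_left_mono) auto
  then have ratio: "p v / P U v \<le> 2 * real a * (p v / sum p U)"
    using Ppos[of U v] sumpos pos[OF v(1)] v(1) by (simp add: field_simps)
  show ?case
  proof (cases "U = {v}")
    case True
    have "1 \<le> real a" using psubset.prems(4)[of "{v}"] v(1) by (auto simp: independent_set_def)
    moreover have "0 \<le> ln (p v / \<epsilon>)" using eps True by simp
    ultimately have "1 * 1 \<le> 2 * real a * (1 + ln (p v / \<epsilon>))" by (intro mult_mono) auto
    moreover have "{j. j = v \<and> ((j, v) \<in> E \<or> j = v)} = {v}" by auto
    ultimately show ?thesis using True pos[OF v(1)] by simp
  next
    case False
    define U' where "U' = U - {v}"
    have U': "U' \<subset> U" "U' \<noteq> {}" "finite U'" using v False fin by (auto simp: U'_def)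
    have sumpos': "0 < sum p U'" using U' pos by (intro sum_pos) auto
    have sumU: "sum p U = p v + sum p U'" unfolding U'_def using fin v(1) by (simp add: sum.remove)
    have IH: "(\<Sum>u\<in>U'. p u / P U' u) \<le> 2 * real a * (1 + ln (sum p U' / \<epsilon>))"
      unfolding P_def using U' psubset.prems(4) eps by (intro psubset.IH) auto
    have "p v / sum p U = 1 - sum p U' / sum p U"
      using sumpos sumU by (simp add: diff_divide_distrib field_simps)
    also have "\<dots> \<le> - ln (sum p U' / sum p U)"
      using ln_le_minus_one[of "sum p U' / sum p U"] sumpos sumpos' by simp
    also have "\<dots> = ln (sum p U / \<epsilon>) - ln (sum p U' / \<epsilon>)"
      using sumpos sumpos' eps(1) by (simp add: ln_div)
    finally have "2 * real a * (p v / sum p U) \<le> 2 * real a * (ln (sum p U / \<epsilon>) - ln (sum p U' / \<epsilon>))"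
      by (intro mult_left_mono) auto
    moreover have "(\<Sum>u\<in>U'. p u / P U u) \<le> (\<Sum>u\<in>U'. p u / P U' u)"
    proof (intro sum_mono divide_left_mono)
      fix u assume u: "u \<in> U'"
      show "P U' u \<le> P U u" unfolding P_def
        using fin pos U' by (intro sum_mono2) (auto simp: less_imp_le)
      show "0 \<le> p u" using u U' pos by (auto simp: less_imp_le)
      show "0 < P U u * P U' u" using Ppos[of U u] Ppos[of U' u] u U' by (intro mult_pos_pos) auto
    qed
    moreover have "(\<Sum>u\<in>U. p u / P U u) = p v / P U v + (\<Sum>u\<in>U'. p u / P U u)"
      unfolding U'_def using fin v(1) by (simp add: sum.remove)
    ultimately have "(\<Sum>u\<in>U. p u / P U u) \<le>
        2 * real a * (ln (sum p U / \<epsilon>) - ln (sum p U' / \<epsilon>)) + 2 * real a * (1 + ln (sum p U' / \<epsilon>))"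
      using IH ratio by linarith
    then show ?thesis by (simp only: P_def algebra_simps)
  qed
qed

text \<open>Averaging over \<open>y\<close>: every target has in-neighbours of relative weight at
  least \<theta>, so some vertex covers a \<theta>-fraction of whatever is still uncovered.\<close>

lemma greedy_cover:
  fixes y :: "nat \<Rightarrow> real"
  assumes "finite V" "finite X" "\<And>v. v \<in> V \<Longrightarrow> 0 \<le> y v" "0 < sum y V" "\<theta> \<le> 1"
    and dense: "\<And>w. w \<in> X \<Longrightarrow> \<theta> * sum y V \<le> sum y {v\<in>V. (v, w) \<in> E}"
  shows "\<exists>D\<subseteq>V. card D \<le> n \<and> real (card {w\<in>X. \<forall>d\<in>D. (d, w) \<notin> E}) \<le> (1 - \<theta>) ^ n * card X"
proof (induction n)
  case 0
  then show ?case by (intro exI[of _ "{}"]) auto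
next
  case (Suc n)
  then obtain D where D: "D \<subseteq> V" "card D \<le> n"
    "real (card {w\<in>X. \<forall>d\<in>D. (d, w) \<notin> E}) \<le> (1 - \<theta>) ^ n * card X" by auto
  define Y where "Y = {w\<in>X. \<forall>d\<in>D. (d, w) \<notin> E}"
  have finY: "finite Y" using assms by (auto simp: Y_def)
  have "\<exists>v\<in>V. \<theta> * card Y \<le> card {w\<in>Y. (v, w) \<in> E}"
  proof (rule ccontr)
    assume "\<not> ?thesis"
    then have *: "\<And>v. v \<in> V \<Longrightarrow> card {w\<in>Y. (v, w) \<in> E} < \<theta> * card Y" by auto
    obtain v0 where v0: "v0 \<in> V" "0 < y v0"
      using assms(3,4) by (metis not_less sum_nonpos)
    have "(\<Sum>v\<in>V. y v * card {w\<in>Y. (v, w) \<in> E}) < (\<Sum>v\<in>V. y v * (\<theta> * card Y))"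
    proof (intro sum_strict_mono_ex1)
      show "\<forall>v\<in>V. y v * card {w\<in>Y. (v, w) \<in> E} \<le> y v * (\<theta> * card Y)"
        using * assms(3) by (simp add: mult_left_mono less_imp_le)
      show "\<exists>v\<in>V. y v * card {w\<in>Y. (v, w) \<in> E} < y v * (\<theta> * card Y)"
        using * v0 by (intro bexI[of _ v0] mult_strict_left_mono)
    qed (rule assms(1))
    also have "\<dots> = (\<Sum>w\<in>Y. \<theta> * sum y V)" by (simp flip: sum_distrib_right)
    also have "\<dots> \<le> (\<Sum>w\<in>Y. sum y {v\<in>V. (v, w) \<in> E})"
      using dense by (intro sum_mono) (auto simp: Y_def)
    also have "\<dots> = (\<Sum>w\<in>Y. \<Sum>v\<in>V. if (v, w) \<in> E then y v else 0)"
      using assms(1) by (simp add: sum.inter_filter)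
    also have "\<dots> = (\<Sum>v\<in>V. \<Sum>w\<in>Y. if (v, w) \<in> E then y v else 0)" by (rule sum.swap)
    also have "\<dots> = (\<Sum>v\<in>V. y v * card {w\<in>Y. (v, w) \<in> E})"
      using finY by (simp add: mult.commute flip: sum.inter_filter)
    finally show False by simp
  qed
  then obtain v where v: "v \<in> V" "\<theta> * card Y \<le> card {w\<in>Y. (v, w) \<in> E}" by auto
  have eq: "{w\<in>X. \<forall>d\<in>insert v D. (d, w) \<notin> E} = Y - {w\<in>Y. (v, w) \<in> E}"
    by (auto simp: Y_def)
  have "real (card {w\<in>X. \<forall>d\<in>insert v D. (d, w) \<notin> E}) = card Y - real (card {w\<in>Y. (v, w) \<in> E})"
    unfolding eq using finY by (subst card_Diff_subset) (auto simp: of_nat_diff card_mono)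
  also have "\<dots> \<le> (1 - \<theta>) * card Y" using v(2) by (simp add: algebra_simps)
  also have "\<dots> \<le> (1 - \<theta>) * ((1 - \<theta>) ^ n * card X)"
    using D(3) assms(5) by (intro mult_left_mono) (auto simp: Y_def)
  finally show ?case using D v(1)
    by (intro exI[of _ "insert v D"]) (auto simp: card_insert_if mult_ac finite_subset[OF _ assms(1)])
qed

section \<open>The weak domination number and thinly dominated sets\<close>

definition weak_vertices :: "nat \<Rightarrow> (nat \<times> nat) set \<Rightarrow> nat set" where
  "weak_vertices K E = {w. w < K \<and> weakly_observable_vertex K E w}"

lemma weak_domination_number_le:
  assumes "D \<subseteq> {..<K}" "\<And>w. w \<in> weak_vertices K E \<Longrightarrow> \<exists>d\<in>D. (d, w) \<in> E"
  shows "weak_domination_number K E \<le> card D"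
proof -
  have "weakly_dominating_set K E D"
    using assms by (auto simp: weakly_dominating_set_def weak_vertices_def out_nbrs_def)
  moreover have "finite {D. weakly_dominating_set K E D}"
    by (rule finite_subset[of _ "Pow {..<K}"]) (auto simp: weakly_dominating_set_def)
  ultimately show ?thesis
    unfolding weak_domination_number_def by (intro Min_le) auto
qed

lemma obtain_weak_dominating_set:
  obtains D where "D \<subseteq> {..<K}" "card D = weak_domination_number K E"
    "\<forall>w\<in>weak_vertices K E. \<exists>d\<in>D. (d, w) \<in> E"
proof -
  have "weakly_dominating_set K E {..<K}"
    by (auto simp: weakly_dominating_set_def weakly_observable_vertex_def observable_vertex_def
        in_nbrs_def out_nbrs_def)
  moreover have "finite {D. weakly_dominating_set K E D}"
    by (rule finite_subset[of _ "Pow {..<K}"]) (auto simp: weakly_dominating_set_def)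
  ultimately have "weak_domination_number K E \<in> card ` {D. weakly_dominating_set K E D}"
    unfolding weak_domination_number_def by (intro Min_in) auto
  then obtain D where "weakly_dominating_set K E D" "card D = weak_domination_number K E" by force
  then show thesis
    by (intro that[of D]) (auto simp: weakly_dominating_set_def weak_vertices_def out_nbrs_def)
qed

text \<open>Potential argument: with weights \<open>2 ^ (number of dominated elements)\<close> on the vertices, some
  unused weak vertex has in-neighbours of relative weight at most \<open>\<theta>\<close>, since otherwise the greedy
  cover would give a dominating set smaller than the weak domination number.\<close>

lemma exists_thinly_dominated_set:
  fixes \<Lambda> :: real
  assumes "1 \<le> K" "0 < \<Lambda>" "ln K < \<Lambda>" "4 \<le> weak_domination_number K E"
    and "4 * r \<le> weak_domination_number K E"
  defines "\<theta> \<equiv> 2 * \<Lambda> / weak_domination_number K E"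
  shows "\<exists>U\<subseteq>weak_vertices K E. card U = r \<and>
    (\<Sum>v<K. 2 ^ card {w\<in>U. (v, w) \<in> E}) \<le> K * (1 + \<theta>) ^ r"
  using assms(5)
proof (induction r)
  case 0
  then show ?case by (intro exI[of _ "{}"]) auto
next
  case (Suc r)
  then obtain U where U: "U \<subseteq> weak_vertices K E" "card U = r"
    "(\<Sum>v<K. 2 ^ card {w\<in>U. (v, w) \<in> E}) \<le> K * (1 + \<theta>) ^ r" by auto
  define y :: "nat \<Rightarrow> real" where "y v = 2 ^ card {w\<in>U. (v, w) \<in> E}" for v
  define \<delta> where "\<delta> = weak_domination_number K E"
  have \<theta>: "0 < \<theta>" using assms by (auto simp: \<theta>_def)
  have finW: "finite (weak_vertices K E)" by (simp add: weak_vertices_def)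
  have finU: "finite U" using U(1) finW by (rule finite_subset)
  have "\<exists>w\<in>weak_vertices K E - U. sum y {v\<in>{..<K}. (v, w) \<in> E} \<le> \<theta> * sum y {..<K}"
  proof (rule ccontr)
    assume "\<not> ?thesis"
    then have *: "\<And>w. w \<in> weak_vertices K E - U \<Longrightarrow>
      \<theta> * sum y {..<K} < sum y {v\<in>{..<K}. (v, w) \<in> E}" by force
    have "0 \<in> {..<K}" using assms(1) by simp
    then have ypos: "0 < sum y {..<K}" by (intro sum_pos) (auto simp: y_def simp del: lessThan_iff)
    \<comment> \<open>One in-neighbour per element dominates \<open>U\<close> with at most
      \<open>r\<close> vertices. The greedy cover may then spend \<open>\<delta> - 1 - r\<close>
      vertices on the rest, for a total below \<delta>.\<close>
    have "\<exists>f. \<forall>u\<in>U. f u < K \<and> (f u, u) \<in> E"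
      using U(1) by (intro bchoice) (auto simp: weak_vertices_def weakly_observable_vertex_def
        observable_vertex_def in_nbrs_def)
    then obtain f where f: "\<And>u. u \<in> U \<Longrightarrow> f u < K \<and> (f u, u) \<in> E" by auto
    have "weak_vertices K E - U \<noteq> {}"
    proof
      assume "weak_vertices K E - U = {}"
      then have "\<delta> \<le> card (f ` U)" unfolding \<delta>_def
        using f by (intro weak_domination_number_le) auto
      then show False using card_image_le[OF finU, of f] U(2) Suc.prems by (simp add: \<delta>_def)
    qed
    then obtain w where w: "w \<in> weak_vertices K E - U" by auto
    have "sum y {v\<in>{..<K}. (v, w) \<in> E} \<le> sum y {..<K}"
      by (intro sum_mono2) (auto simp: y_def)
    with *[OF w] have "\<theta> * sum y {..<K} < 1 * sum y {..<K}" by simp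
    then have "\<theta> < 1" using ypos by (simp add: mult_less_cancel_right)
    then obtain D where D: "D \<subseteq> {..<K}" "card D \<le> \<delta> - 1 - r"
      "real (card {w\<in>weak_vertices K E - U. \<forall>d\<in>D. (d, w) \<notin> E}) \<le>
        (1 - \<theta>) ^ (\<delta> - 1 - r) * card (weak_vertices K E - U)"
      using greedy_cover[where V="{..<K}" and X="weak_vertices K E - U" and y=y and \<theta>=\<theta>
          and n="\<delta> - 1 - r" and E=E] finW ypos *
      by (auto simp: y_def less_imp_le)
    have "real (card (weak_vertices K E - U)) \<le> K"
      using card_mono[of "{..<K}" "weak_vertices K E - U"] by (auto simp: weak_vertices_def)
    then have "(1 - \<theta>) ^ (\<delta> - 1 - r) * card (weak_vertices K E - U) \<le> (1 - \<theta>) ^ (\<delta> - 1 - r) * K"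
      using \<open>\<theta> < 1\<close> by (intro mult_left_mono) auto
    also have "(1 - \<theta>) ^ (\<delta> - 1 - r) \<le> exp (- \<theta>) ^ (\<delta> - 1 - r)"
      using exp_ge_add_one_self[of "- \<theta>"] \<open>\<theta> < 1\<close> by (intro power_mono) auto
    also have "exp (- \<theta>) ^ (\<delta> - 1 - r) = exp (- (\<theta> * real (\<delta> - 1 - r)))"
      by (simp flip: exp_of_nat_mult add: mult.commute)
    also have "\<dots> \<le> exp (- \<Lambda>)"
    proof -
      \<comment> \<open>Since \<open>4 * Suc r\<close> is at most \<delta>, the greedy cover has at
        least \<open>\<delta> / 2\<close> steps; the factor 2 in \<open>\<theta>\<close> compensates
        the halving. The resulting \<open>exp (- \<Lambda>) < 1 / K\<close> leaves less than one
        vertex uncovered.\<close>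
      have "real \<delta> / 2 \<le> real (\<delta> - 1 - r)"
        using assms(4) Suc.prems by (auto simp: \<delta>_def)
      then have "\<theta> * (real \<delta> / 2) \<le> \<theta> * real (\<delta> - 1 - r)"
        using \<theta> by (intro mult_left_mono) auto
      moreover have "\<theta> * (real \<delta> / 2) = \<Lambda>" using assms(4) by (simp add: \<theta>_def \<delta>_def)
      ultimately show ?thesis by simp
    qed
    also have "exp (- \<Lambda>) < 1 / K"
    proof -
      have "exp (- \<Lambda>) < exp (- ln K)" using assms(3) by simp
      then show ?thesis using assms(1) by (simp add: exp_minus inverse_eq_divide)
    qed
    finally have "real (card {w\<in>weak_vertices K E - U. \<forall>d\<in>D. (d, w) \<notin> E}) < 1"
      using D(3) assms(1) by (simp add: mult_right_mono mult_strict_right_mono)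
    then have "{w\<in>weak_vertices K E - U. \<forall>d\<in>D. (d, w) \<notin> E} = {}"
      using finW by simp
    then have "\<exists>d\<in>D \<union> f ` U. (d, w) \<in> E" if "w \<in> weak_vertices K E" for w
      using f[of w] that by (cases "w \<in> U") auto
    then have "\<delta> \<le> card (D \<union> f ` U)" unfolding \<delta>_def
      using f D(1) by (intro weak_domination_number_le) auto
    also have "\<dots> \<le> card D + card (f ` U)" by (rule card_Un_le)
    also have "\<dots> \<le> (\<delta> - 1 - r) + r" using D(2) card_image_le[OF finU, of f] U(2) by simp
    finally show False using Suc.prems assms(4) by (simp add: \<delta>_def)
  qed
  then obtain w where w: "w \<in> weak_vertices K E" "w \<notin> U"
    "sum y {v\<in>{..<K}. (v, w) \<in> E} \<le> \<theta> * sum y {..<K}" by auto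
  \<comment> \<open>Adding \<open>w\<close> doubles the weight of each in-neighbour of
    \<open>w\<close> and changes no other weight.\<close>
  have "(\<Sum>v<K. 2 ^ card {u\<in>insert w U. (v, u) \<in> E}) =
      (\<Sum>v<K. y v + (if (v, w) \<in> E then y v else 0))"
  proof (intro sum.cong refl)
    fix v
    have "{u\<in>insert w U. (v, u) \<in> E} =
        (if (v, w) \<in> E then insert w {u\<in>U. (v, u) \<in> E} else {u\<in>U. (v, u) \<in> E})" by auto
    then show "2 ^ card {u\<in>insert w U. (v, u) \<in> E} = y v + (if (v, w) \<in> E then y v else 0)"
      using finU w(2) by (auto simp: y_def)
  qed
  also have "\<dots> = sum y {..<K} + sum y {v\<in>{..<K}. (v, w) \<in> E}"
    by (subst sum.inter_filter) (simp_all add: sum.distrib)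
  also have "\<dots> \<le> (1 + \<theta>) * sum y {..<K}" using w(3) by (simp add: algebra_simps)
  also have "\<dots> \<le> (1 + \<theta>) * (K * (1 + \<theta>) ^ r)"
    using U(3) \<theta> by (intro mult_left_mono) (auto simp: y_def)
  finally show ?case using U w finU
    by (intro exI[of _ "insert w U"]) (auto simp: algebra_simps)
qed

text \<open>As \<open>\<theta> * r \<le> 1\<close>, the potential stays below
  \<open>K * exp 1\<close>; so does each summand, which makes all degrees into \<open>U\<close>
  logarithmic. Small out-degrees inside \<open>U\<close> then give a large independent subset, by
  \<open>weighted_turan\<close> with unit weights on the reversed graph.\<close>

lemma exists_thinly_dominated_independent_set:
  fixes \<Lambda> :: real
  assumes "1 \<le> K" "1 \<le> \<Lambda>" "ln K < \<Lambda>" "4 \<le> weak_domination_number K E"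
    and r: "4 * r \<le> weak_domination_number K E" "2 * \<Lambda> * r \<le> weak_domination_number K E"
  shows "\<exists>S\<subseteq>weak_vertices K E. independent_set E S \<and> r \<le> (8 * \<Lambda>) * card S \<and>
    (\<forall>v<K. card {w\<in>S. (v, w) \<in> E} \<le> 3 * \<Lambda>)"
proof -
  define \<theta> where "\<theta> = 2 * \<Lambda> / weak_domination_number K E"
  obtain U where U: "U \<subseteq> weak_vertices K E" "card U = r"
    "(\<Sum>v<K. 2 ^ card {w\<in>U. (v, w) \<in> E}) \<le> K * (1 + \<theta>) ^ r"
    using exists_thinly_dominated_set[of K \<Lambda> E r] assms unfolding \<theta>_def by auto
  have finU: "finite U" using U(1) by (rule finite_subset) (simp add: weak_vertices_def)
  have \<theta>: "0 < \<theta>" "\<theta> * r \<le> 1" using assms by (auto simp: \<theta>_def field_simps)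
  have "(1 + \<theta>) ^ r \<le> exp \<theta> ^ r" using \<theta> by (intro power_mono) auto
  also have "\<dots> = exp (\<theta> * r)" by (simp flip: exp_of_nat_mult add: mult.commute)
  also have "\<dots> \<le> exp 1" using \<theta> by simp
  finally have e: "(1 + \<theta>) ^ r \<le> exp 1" .
  have deg: "card {w\<in>U. (v, w) \<in> E} \<le> 3 * \<Lambda>" if v: "v < K" for v
  proof -
    have "2 ^ card {w\<in>U. (v, w) \<in> E} \<le> (\<Sum>v<K. (2::real) ^ card {w\<in>U. (v, w) \<in> E})"
      using v by (intro member_le_sum) auto
    also have "\<dots> \<le> K * exp 1" using U(3) e by (meson mult_left_mono of_nat_0_le_iff order_trans)
    finally have "ln (2 ^ card {w\<in>U. (v, w) \<in> E}) \<le> ln (K * exp 1)"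
      using assms(1) by (subst ln_le_cancel_iff) auto
    then have *: "card {w\<in>U. (v, w) \<in> E} * ln 2 \<le> ln K + 1"
      using assms(1) by (simp add: ln_realpow ln_mult)
    \<comment> \<open>\<open>ln 2 \<ge> 2/3\<close> and \<open>ln K + 1 \<le> 2 * \<Lambda>\<close>
      give the constant 3.\<close>
    have "card {w\<in>U. (v, w) \<in> E} * (2/3) \<le> card {w\<in>U. (v, w) \<in> E} * ln (2::real)"
      using ln2_ge_two_thirds by (intro mult_left_mono) auto
    then show ?thesis using * assms(2,3) by simp
  qed
  have "sum (\<lambda>_. 1::real) {j\<in>U. (j, v) \<in> E\<inverse> \<or> j = v} \<le> 3 * \<Lambda> + 1" if "v \<in> U" for v
  proof -
    have "{j\<in>U. (j, v) \<in> E\<inverse> \<or> j = v} = insert v {w\<in>U. (v, w) \<in> E}" using that by auto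
    then have "card {j\<in>U. (j, v) \<in> E\<inverse> \<or> j = v} \<le> Suc (card {w\<in>U. (v, w) \<in> E})"
      using finU by (simp add: card_insert_if)
    then have "real (card {j\<in>U. (j, v) \<in> E\<inverse> \<or> j = v}) \<le> 1 + real (card {w\<in>U. (v, w) \<in> E})"
      by linarith
    then show ?thesis using deg[of v] that U(1) by (auto simp: weak_vertices_def)
  qed
  then obtain S where S: "S \<subseteq> U" "independent_set (E\<inverse>) S"
      "sum (\<lambda>_. 1::real) U \<le> 2 * (3 * \<Lambda> + 1) * card S"
    using weighted_turan[where U=U and p="\<lambda>_. 1" and E="E\<inverse>" and \<beta>="3 * \<Lambda> + 1"] finU by auto
  have "card {w\<in>S. (v, w) \<in> E} \<le> 3 * \<Lambda>" if "v < K" for v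
  proof -
    have "card {w\<in>S. (v, w) \<in> E} \<le> card {w\<in>U. (v, w) \<in> E}"
      using S(1) finU by (intro card_mono) auto
    then show ?thesis using deg[OF that] by linarith
  qed
  moreover have "r \<le> (8 * \<Lambda>) * card S"
  proof -
    have "real r \<le> 2 * (3 * \<Lambda> + 1) * card S" using S(3) U(2) by simp
    also have "\<dots> \<le> (8 * \<Lambda>) * card S" using assms(2) by (intro mult_right_mono) auto
    finally show ?thesis .
  qed
  moreover have "independent_set E S" using S(2) by (auto simp: independent_set_def)
  ultimately show ?thesis using S(1) U(1) by blast
qed

section \<open>Histories under random losses\<close>

lemma expectation_bind_finite:
  fixes h :: "'b \<Rightarrow> real"
  assumes "finite (set_pmf p)" "\<And>x. x \<in> set_pmf p \<Longrightarrow> finite (set_pmf (f x))"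
  shows "measure_pmf.expectation (bind_pmf p f) h =
    measure_pmf.expectation p (\<lambda>x. measure_pmf.expectation (f x) h)"
  using pmf_expectation_bind[of "set_pmf p" f p h] assms
    integral_measure_pmf[of "set_pmf p" p "\<lambda>x. measure_pmf.expectation (f x) h"] by auto

lemma expectation_cong:
  fixes f g :: "'a \<Rightarrow> real"
  assumes "\<And>x. x \<in> set_pmf p \<Longrightarrow> f x = g x"
  shows "measure_pmf.expectation p f = measure_pmf.expectation p g"
  using assms by (intro integral_cong_AE) (auto simp: AE_measure_pmf_iff)

context
  fixes p :: "'a pmf" and f g :: "'a \<Rightarrow> real"
  assumes fin: "finite (set_pmf p)"
begin

lemma expectation_add:
  "measure_pmf.expectation p (\<lambda>x. f x + g x) =
    measure_pmf.expectation p f + measure_pmf.expectation p g"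
  using fin by (intro Bochner_Integration.integral_add integrable_measure_pmf_finite)

lemma expectation_diff:
  "measure_pmf.expectation p (\<lambda>x. f x - g x) =
    measure_pmf.expectation p f - measure_pmf.expectation p g"
  using fin by (intro Bochner_Integration.integral_diff integrable_measure_pmf_finite)

lemma expectation_mono:
  assumes "\<And>x. x \<in> set_pmf p \<Longrightarrow> f x \<le> g x"
  shows "measure_pmf.expectation p f \<le> measure_pmf.expectation p g"
  using fin assms by (intro integral_mono_AE integrable_measure_pmf_finite) (auto simp: AE_measure_pmf_iff)

end

lemma expectation_sum:
  fixes f :: "'b \<Rightarrow> 'a \<Rightarrow> real"
  assumes "finite (set_pmf p)"
  shows "measure_pmf.expectation p (\<lambda>x. \<Sum>i\<in>I. f i x) = (\<Sum>i\<in>I. measure_pmf.expectation p (f i))"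
  using assms by (intro Bochner_Integration.integral_sum integrable_measure_pmf_finite)

lemma finite_set_valid_strategy: "valid_strategy K s \<Longrightarrow> finite (set_pmf (s h))"
  by (meson finite_lessThan finite_subset valid_strategy_def)

definition observe :: "(nat \<times> nat) set \<Rightarrow> (nat \<Rightarrow> real) \<Rightarrow> nat \<Rightarrow> nat \<Rightarrow> real option" where
  "observe E x i = (\<lambda>j. if (i, j) \<in> E then Some (x j) else None)"

lemma observation_eq: "observation E l t i = observe E (l t) i"
  by (simp add: observation_def observe_def)

text \<open>The game against loss vectors drawn afresh from \<nu> in each round. The draw follows
  the choice of the action and is thus visibly independent of it.\<close>

fun iid_dist :: "(nat \<times> nat) set \<Rightarrow> strategy \<Rightarrow> (nat \<Rightarrow> real) pmf \<Rightarrow> nat \<Rightarrow> history pmf" where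
  "iid_dist E s \<nu> 0 = return_pmf []"
| "iid_dist E s \<nu> (Suc t) =
     bind_pmf (iid_dist E s \<nu> t) (\<lambda>h.
       bind_pmf (s h) (\<lambda>i. bind_pmf \<nu> (\<lambda>x. return_pmf (h @ [(i, observe E x i)]))))"

definition total :: "(nat \<Rightarrow> real) \<Rightarrow> history \<Rightarrow> real" where
  "total c h = (\<Sum>z\<leftarrow>h. c (fst z))"

lemma total_simps [simp]: "total c [] = 0" "total c (h @ [z]) = total c h + c (fst z)"
  by (auto simp: total_def)

lemma total_nonneg: "(\<And>i. 0 \<le> c i) \<Longrightarrow> 0 \<le> total c h"
  by (induction h rule: rev_induct) auto

lemma finite_history_dist:
  assumes "valid_strategy K s"
  shows "finite (set_pmf (history_dist E s l t))"
  using finite_set_valid_strategy[OF assms] by (induction t) auto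

lemma history_dist_support:
  assumes "valid_strategy K s" "h \<in> set_pmf (history_dist E s l t)"
  shows "length h = t"
  using assms by (induction t arbitrary: h) auto

lemma finite_iid_dist:
  assumes "valid_strategy K s" "finite (set_pmf \<nu>)"
  shows "finite (set_pmf (iid_dist E s \<nu> t))"
  using finite_set_valid_strategy[OF assms(1)] assms(2) by (induction t) auto

lemma iid_dist_support:
  assumes "valid_strategy K s" "h \<in> set_pmf (iid_dist E s \<nu> t)"
  shows "length h = t" "fst ` set h \<subseteq> {..<K}"
  using assms by (induction t arbitrary: h) (fastforce simp: valid_strategy_def)+

lemma history_dist_cong:
  assumes "\<And>t'. t' < t \<Longrightarrow> l t' = l' t'"
  shows "history_dist E s l t = history_dist E s l' t"
  using assms by (induction t) (auto simp: observation_eq)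

text \<open>The history before round \<open>t\<close> determines the law of the next action, so each
  loss can be averaged over that action alone. Upper and lower bounds both use the regret in this
  per-round form.\<close>

lemma expected_cumulative_loss:
  assumes "valid_strategy K s"
  shows "measure_pmf.expectation (history_dist E s l T) (\<lambda>h. \<Sum>t<T. l t (fst (h ! t))) =
    (\<Sum>t<T. measure_pmf.expectation (history_dist E s l t) (\<lambda>h. measure_pmf.expectation (s h) (l t)))"
proof (induction T)
  case 0
  then show ?case by simp
next
  case (Suc T)
  note fin = finite_history_dist[OF assms] finite_set_valid_strategy[OF assms]
  have "measure_pmf.expectation (history_dist E s l (Suc T)) (\<lambda>h. \<Sum>t<Suc T. l t (fst (h ! t))) =
    measure_pmf.expectation (history_dist E s l T) (\<lambda>h. measure_pmf.expectation (s h)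
      (\<lambda>i. \<Sum>t<Suc T. l t (fst ((h @ [(i, observation E l T i)]) ! t))))"
    using fin by (simp add: expectation_bind_finite del: sum.lessThan_Suc)
  also have "\<dots> = measure_pmf.expectation (history_dist E s l T) (\<lambda>h. measure_pmf.expectation (s h)
      (\<lambda>i. (\<Sum>t<T. l t (fst (h ! t))) + l T i))"
    by (intro expectation_cong) (auto dest!: history_dist_support[OF assms] simp: nth_append
        intro!: sum.cong)
  also have "\<dots> = measure_pmf.expectation (history_dist E s l T) (\<lambda>h. (\<Sum>t<T. l t (fst (h ! t))))
      + measure_pmf.expectation (history_dist E s l T) (\<lambda>h. measure_pmf.expectation (s h) (l T))"
    using fin by (simp add: expectation_add)
  finally show ?case using Suc.IH by simp
qed

lemma expectation_total:
  assumes "valid_strategy K s" "finite (set_pmf \<nu>)"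
  shows "measure_pmf.expectation (iid_dist E s \<nu> T) (total c) =
    (\<Sum>t<T. measure_pmf.expectation (iid_dist E s \<nu> t) (\<lambda>h. measure_pmf.expectation (s h) c))"
proof (induction T)
  case (Suc T)
  note fin = finite_iid_dist[OF assms] finite_set_valid_strategy[OF assms(1)] assms(2)
  have "measure_pmf.expectation (iid_dist E s \<nu> (Suc T)) (total c) =
    measure_pmf.expectation (iid_dist E s \<nu> T) (\<lambda>h. measure_pmf.expectation (s h) (\<lambda>i. total c h + c i))"
    using fin by (simp add: expectation_bind_finite)
  also have "\<dots> = measure_pmf.expectation (iid_dist E s \<nu> T) (total c) +
    measure_pmf.expectation (iid_dist E s \<nu> T) (\<lambda>h. measure_pmf.expectation (s h) c)"
    using fin by (simp add: expectation_add)
  finally show ?case using Suc.IH by simp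
qed simp

text \<open>At time \<open>t\<close> the history depends only on the losses before \<open>t\<close>, so the current loss vector
  may be resampled independently of it.\<close>

lemma mixture_resample:
  assumes "t < T"
    and "bind_pmf (Pi_pmf {..<T} d (\<lambda>_. \<nu>)) (\<lambda>l. history_dist E s l t) = iid_dist E s \<nu> t"
  shows "bind_pmf (Pi_pmf {..<T} d (\<lambda>_. \<nu>)) (\<lambda>l. bind_pmf (history_dist E s l t) (\<lambda>h. F h (l t))) =
    bind_pmf (iid_dist E s \<nu> t) (\<lambda>h. bind_pmf \<nu> (F h))"
proof -
  define \<rho> where "\<rho> = Pi_pmf ({..<T} - {t}) d (\<lambda>_. \<nu>)"
  have "{..<T} = insert t ({..<T} - {t})" using assms by auto
  then have split: "Pi_pmf {..<T} d (\<lambda>_. \<nu>) =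
      bind_pmf \<nu> (\<lambda>x. bind_pmf \<rho> (\<lambda>f. return_pmf (f(t := x))))"
    unfolding \<rho>_def by (metis Pi_pmf_insert' Diff_iff finite_Diff finite_lessThan insertI1)
  have upd: "history_dist E s (f(t := x)) t = history_dist E s f t" for f x
    by (intro history_dist_cong) auto
  have iid: "bind_pmf \<rho> (\<lambda>f. history_dist E s f t) = iid_dist E s \<nu> t"
    using assms(2) unfolding split by (simp add: bind_assoc_pmf bind_return_pmf upd)
  have "bind_pmf (Pi_pmf {..<T} d (\<lambda>_. \<nu>)) (\<lambda>l. bind_pmf (history_dist E s l t) (\<lambda>h. F h (l t))) =
     bind_pmf \<nu> (\<lambda>x. bind_pmf \<rho> (\<lambda>f. bind_pmf (history_dist E s f t) (\<lambda>h. F h x)))"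
    unfolding split by (simp add: bind_assoc_pmf bind_return_pmf upd)
  also have "\<dots> = bind_pmf \<nu> (\<lambda>x. bind_pmf (iid_dist E s \<nu> t) (\<lambda>h. F h x))"
    by (simp add: bind_assoc_pmf flip: iid)
  also have "\<dots> = bind_pmf (iid_dist E s \<nu> t) (\<lambda>h. bind_pmf \<nu> (F h))"
    by (rule bind_commute_pmf)
  finally show ?thesis .
qed

text \<open>Drawing the whole loss sequence before the game or each vector when it is needed yields
  the same histories. This makes random losses usable although the game fixes the losses in
  advance.\<close>

lemma mixture_history_dist:
  assumes "t \<le> T"
  shows "bind_pmf (Pi_pmf {..<T} d (\<lambda>_. \<nu>)) (\<lambda>l. history_dist E s l t) = iid_dist E s \<nu> t"
  using assms
proof (induction t)
  case (Suc t)
  then have IH: "bind_pmf (Pi_pmf {..<T} d (\<lambda>_. \<nu>)) (\<lambda>l. history_dist E s l t) = iid_dist E s \<nu> t"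
    and "t < T" by auto
  have "bind_pmf (Pi_pmf {..<T} d (\<lambda>_. \<nu>)) (\<lambda>l. history_dist E s l (Suc t)) =
    bind_pmf (iid_dist E s \<nu> t) (\<lambda>h. bind_pmf \<nu> (\<lambda>x.
      bind_pmf (s h) (\<lambda>i. return_pmf (h @ [(i, observe E x i)]))))"
    using mixture_resample[OF \<open>t < T\<close> IH,
        of "\<lambda>h x. bind_pmf (s h) (\<lambda>i. return_pmf (h @ [(i, observe E x i)]))"]
    by (simp add: observation_eq)
  also have "\<dots> = iid_dist E s \<nu> (Suc t)"
    by (auto intro!: bind_pmf_cong bind_commute_pmf)
  finally show ?case .
qed simp

lemma expected_regret_ge:
  assumes "valid_strategy K s" "k < K"
  shows "expected_regret K E s l T \<ge>
    (\<Sum>t<T. measure_pmf.expectation (history_dist E s l t) (\<lambda>h. measure_pmf.expectation (s h) (l t)) - l t k)"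
proof -
  have "Min ((\<lambda>i. \<Sum>t<T. l t i) ` {..<K}) \<le> (\<Sum>t<T. l t k)"
    using assms(2) by (intro Min_le) auto
  then show ?thesis
    by (simp add: expected_regret_def expected_cumulative_loss[OF assms(1)] sum_subtractf)
qed

text \<open>A regret bound for every fixed sequence survives averaging over independent draws. The
  minimum over actions is replaced by the fixed comparator \<open>k\<close> before averaging, which
  leaves gaps between means.\<close>

lemma regret_bound_ge_pseudo_regret:
  assumes s: "valid_strategy K s" and k: "k < K" and fin: "finite (set_pmf \<nu>)"
    and valid: "\<And>x i. x \<in> set_pmf \<nu> \<Longrightarrow> 0 \<le> x i \<and> x i \<le> 1"
    and R: "\<And>l. valid_losses l \<Longrightarrow> expected_regret K E s l T \<le> R"
  shows "measure_pmf.expectation (iid_dist E s \<nu> T)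
    (total (\<lambda>i. measure_pmf.expectation \<nu> (\<lambda>x. x i) - measure_pmf.expectation \<nu> (\<lambda>x. x k))) \<le> R"
proof -
  define Q where "Q = Pi_pmf {..<T} (\<lambda>_. 0) (\<lambda>_. \<nu>)"
  define \<mu> where "\<mu> i = measure_pmf.expectation \<nu> (\<lambda>x. x i)" for i
  note finS = finite_set_valid_strategy[OF s] and finH = finite_history_dist[OF s]
    and finI = finite_iid_dist[OF s fin]
  have setQ: "set_pmf Q = PiE_dflt {..<T} (\<lambda>_. 0) (\<lambda>_. set_pmf \<nu>)"
    unfolding Q_def by (simp add: set_Pi_pmf o_def)
  have finQ: "finite (set_pmf Q)" unfolding setQ using fin by (intro finite_PiE_dflt) auto
  have validQ: "valid_losses l" if l: "l \<in> set_pmf Q" for l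
    unfolding valid_losses_def
  proof (intro allI)
    fix t i show "0 \<le> l t i \<and> l t i \<le> 1"
      using valid[of "l t" i] l by (cases "t < T") (auto simp: setQ PiE_dflt_def)
  qed
  define G where "G l t = measure_pmf.expectation (history_dist E s l t)
    (\<lambda>h. measure_pmf.expectation (s h) (l t))" for l t
  have EG: "measure_pmf.expectation Q (\<lambda>l. G l t) =
    measure_pmf.expectation (iid_dist E s \<nu> t) (\<lambda>h. measure_pmf.expectation (s h) \<mu>)" if "t < T" for t
  proof -
    have "measure_pmf.expectation Q (\<lambda>l. G l t) = measure_pmf.expectation
      (bind_pmf Q (\<lambda>l. bind_pmf (history_dist E s l t) (\<lambda>h. map_pmf (l t) (s h)))) (\<lambda>x. x)"
      unfolding G_def using finQ finH finS by (simp add: expectation_bind_finite)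
    also have "\<dots> = measure_pmf.expectation
      (bind_pmf (iid_dist E s \<nu> t) (\<lambda>h. bind_pmf \<nu> (\<lambda>x. map_pmf x (s h)))) (\<lambda>x. x)"
      unfolding Q_def using that by (subst mixture_resample) (auto simp: mixture_history_dist)
    also have "\<dots> = measure_pmf.expectation
      (bind_pmf (iid_dist E s \<nu> t) (\<lambda>h. bind_pmf (s h) (\<lambda>i. map_pmf (\<lambda>x. x i) \<nu>))) (\<lambda>x. x)"
      unfolding map_pmf_def by (subst bind_commute_pmf) rule
    also have "\<dots> = measure_pmf.expectation (iid_dist E s \<nu> t) (\<lambda>h. measure_pmf.expectation (s h) \<mu>)"
      unfolding \<mu>_def using finI fin finS by (simp add: expectation_bind_finite)
    finally show ?thesis .
  qed
  have E\<mu>: "measure_pmf.expectation Q (\<lambda>l. l t k) = \<mu> k" if "t < T" for t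
  proof -
    have "\<mu> k = measure_pmf.expectation (map_pmf (\<lambda>l. l t) Q) (\<lambda>x. x k)"
      unfolding Q_def \<mu>_def using that by (subst Pi_pmf_component) auto
    then show ?thesis by simp
  qed
  have "measure_pmf.expectation (iid_dist E s \<nu> T) (total (\<lambda>i. \<mu> i - \<mu> k)) =
    (\<Sum>t<T. measure_pmf.expectation (iid_dist E s \<nu> t)
      (\<lambda>h. measure_pmf.expectation (s h) (\<lambda>i. \<mu> i - \<mu> k)))"
    by (rule expectation_total[OF s fin])
  also have "\<dots> = (\<Sum>t<T. measure_pmf.expectation (iid_dist E s \<nu> t)
      (\<lambda>h. measure_pmf.expectation (s h) \<mu>) - \<mu> k)"
    using finI finS by (simp add: expectation_diff)
  also have "\<dots> = (\<Sum>t<T. measure_pmf.expectation Q (\<lambda>l. G l t - l t k))"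
    using finQ by (intro sum.cong) (auto simp: expectation_diff EG E\<mu>)
  also have "\<dots> = measure_pmf.expectation Q (\<lambda>l. \<Sum>t<T. G l t - l t k)"
    using finQ by (simp add: expectation_sum)
  also have "\<dots> \<le> measure_pmf.expectation Q (\<lambda>_. R)"
  proof (intro expectation_mono finQ)
    fix l assume "l \<in> set_pmf Q"
    then show "(\<Sum>t<T. G l t - l t k) \<le> R"
      using R[OF validQ] expected_regret_ge[OF s k, where l=l and T=T and E=E]
      by (force simp: G_def)
  qed
  finally show ?thesis by (simp add: \<mu>_def)
qed

section \<open>Likelihood ratios and regret lower bounds\<close>

text \<open>Coordinate \<open>k\<close> is overwritten by an independent bit, so two coins over the
  same \<rho> differ in the law of that coordinate only.\<close>

definition coin :: "(nat \<Rightarrow> real) pmf \<Rightarrow> nat \<Rightarrow> real \<Rightarrow> (nat \<Rightarrow> real) pmf" where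
  "coin \<rho> k q = bind_pmf (bernoulli_pmf q) (\<lambda>b. map_pmf (\<lambda>x. x(k := of_bool b)) \<rho>)"

lemma finite_set_coin: "finite (set_pmf \<rho>) \<Longrightarrow> finite (set_pmf (coin \<rho> k q))"
  by (simp add: coin_def)

lemma expectation_coin:
  assumes "finite (set_pmf \<rho>)" "0 \<le> q" "q \<le> 1"
  shows "measure_pmf.expectation (coin \<rho> k q) g =
    q * measure_pmf.expectation \<rho> (\<lambda>x. g (x(k := 1))) +
    (1 - q) * measure_pmf.expectation \<rho> (\<lambda>x. g (x(k := 0)))"
  using assms by (simp add: coin_def expectation_bind_finite)

lemma expectation_coin_coordinate:
  assumes "finite (set_pmf \<rho>)" "0 \<le> q" "q \<le> 1"
  shows "measure_pmf.expectation (coin \<rho> k q) (\<lambda>x. x i) =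
    (if i = k then q else measure_pmf.expectation \<rho> (\<lambda>x. x i))"
  using assms by (simp add: expectation_coin algebra_simps)

text \<open>The density of a coin of bias \<open>1/2 - \<epsilon>\<close> with respect to a fair coin, as seen through the
  feedback graph: rounds in which action \<open>k\<close> is not observed contribute the factor 1.\<close>

definition round_ratio :: "real \<Rightarrow> nat \<Rightarrow> (nat \<Rightarrow> real option) \<Rightarrow> real" where
  "round_ratio \<epsilon> k ob = (if ob k = Some 1 then 1 - 2 * \<epsilon> else if ob k = Some 0 then 1 + 2 * \<epsilon> else 1)"

definition likelihood_ratio :: "real \<Rightarrow> nat \<Rightarrow> history \<Rightarrow> real" where
  "likelihood_ratio \<epsilon> k h = (\<Prod>z\<leftarrow>h. round_ratio \<epsilon> k (snd z))"

lemma likelihood_ratio_simps [simp]: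
  "likelihood_ratio \<epsilon> k [] = 1"
  "likelihood_ratio \<epsilon> k (h @ [z]) = likelihood_ratio \<epsilon> k h * round_ratio \<epsilon> k (snd z)"
  by (auto simp: likelihood_ratio_def)

lemma round_ratio_pos: "0 \<le> \<epsilon> \<Longrightarrow> \<epsilon> < 1/2 \<Longrightarrow> 0 < round_ratio \<epsilon> k ob"
  by (auto simp: round_ratio_def)

lemma likelihood_ratio_pos: "0 \<le> \<epsilon> \<Longrightarrow> \<epsilon> < 1/2 \<Longrightarrow> 0 < likelihood_ratio \<epsilon> k h"
  by (induction h rule: rev_induct) (auto simp: round_ratio_pos)

lemma round_ratio_observe:
  "round_ratio \<epsilon> k (observe E (x(k := 1)) i) = (if (i, k) \<in> E then 1 - 2 * \<epsilon> else 1)"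
  "round_ratio \<epsilon> k (observe E (x(k := 0)) i) = (if (i, k) \<in> E then 1 + 2 * \<epsilon> else 1)"
  by (auto simp: round_ratio_def observe_def)

lemma round_ratio_unobserved: "(i, k) \<notin> E \<Longrightarrow> round_ratio \<epsilon> k (observe E x i) = 1"
  by (auto simp: round_ratio_def observe_def)

lemma observe_upd: "(i, k) \<notin> E \<Longrightarrow> observe E (x(k := v)) i = observe E x i"
  by (auto simp: observe_def)

context
  fixes K :: nat and E :: "(nat \<times> nat) set" and s :: strategy and \<rho> :: "(nat \<Rightarrow> real) pmf"
    and \<epsilon> :: real and k :: nat
  assumes s: "valid_strategy K s" and fin\<rho>: "finite (set_pmf \<rho>)" and \<epsilon>: "0 \<le> \<epsilon>" "\<epsilon> \<le> 1/4"
begin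

abbreviation "fair \<equiv> iid_dist E s (coin \<rho> k (1/2))"
abbreviation "biased \<equiv> iid_dist E s (coin \<rho> k (1/2 - \<epsilon>))"

lemma finite_coin_dists:
  "finite (set_pmf (fair t))" "finite (set_pmf (biased t))"
  using finite_iid_dist[OF s] finite_set_coin[OF fin\<rho>] by auto

text \<open>Round by round: a bit of mean \<open>1/2 - \<epsilon>\<close> has density
  \<open>1 - 2 * \<epsilon>\<close> at 1 and \<open>1 + 2 * \<epsilon>\<close> at 0 relative to a
  fair bit; if the action does not reveal \<open>k\<close>, the recorded observation does not depend
  on the bit.\<close>

lemma change_of_measure:
  "measure_pmf.expectation (biased t) f =
    measure_pmf.expectation (fair t) (\<lambda>h. likelihood_ratio \<epsilon> k h * f h)"
proof (induction t arbitrary: f)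
  case (Suc t)
  note fin = finite_coin_dists finite_set_valid_strategy[OF s] finite_set_coin[OF fin\<rho>]
  have step: "measure_pmf.expectation (coin \<rho> k (1/2 - \<epsilon>)) (\<lambda>x. f (h @ [(i, observe E x i)])) =
    measure_pmf.expectation (coin \<rho> k (1/2))
      (\<lambda>x. round_ratio \<epsilon> k (observe E x i) * f (h @ [(i, observe E x i)]))" for h i
  proof (cases "(i, k) \<in> E")
    case True
    then show ?thesis using fin\<rho> \<epsilon>
      by (simp add: expectation_coin round_ratio_observe)
        (simp add: algebra_simps add_divide_distrib diff_divide_distrib)
  next
    case False
    then show ?thesis using fin\<rho> \<epsilon>
      by (simp add: expectation_coin round_ratio_unobserved observe_upd) (simp add: algebra_simps)
  qed
  have "measure_pmf.expectation (biased (Suc t)) f = measure_pmf.expectation (biased t)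
    (\<lambda>h. measure_pmf.expectation (s h) (\<lambda>i. measure_pmf.expectation (coin \<rho> k (1/2 - \<epsilon>))
      (\<lambda>x. f (h @ [(i, observe E x i)]))))"
    using fin by (simp add: expectation_bind_finite)
  also have "\<dots> = measure_pmf.expectation (fair t) (\<lambda>h. likelihood_ratio \<epsilon> k h *
    measure_pmf.expectation (s h) (\<lambda>i. measure_pmf.expectation (coin \<rho> k (1/2))
      (\<lambda>x. round_ratio \<epsilon> k (observe E x i) * f (h @ [(i, observe E x i)]))))"
    by (simp add: Suc.IH step)
  also have "\<dots> = measure_pmf.expectation (fair (Suc t)) (\<lambda>h. likelihood_ratio \<epsilon> k h * f h)"
    using fin by (simp add: expectation_bind_finite mult.assoc)
  finally show ?case .
qed simp

text \<open>Up to sign, the relative entropy of the fair history with respect to the biased one. A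
  round that reveals \<open>k\<close> adds the mean of \<open>ln (1 - 2 * \<epsilon>)\<close> and
  \<open>ln (1 + 2 * \<epsilon>)\<close>, any other round adds 0.\<close>

lemma expectation_ln_likelihood_ratio:
  "measure_pmf.expectation (fair t) (\<lambda>h. ln (likelihood_ratio \<epsilon> k h)) =
    ln (1 - 4 * \<epsilon>\<^sup>2) / 2 * measure_pmf.expectation (fair t) (total (\<lambda>i. of_bool ((i, k) \<in> E)))"
proof (induction t)
  case (Suc t)
  note fin = finite_coin_dists finite_set_valid_strategy[OF s] finite_set_coin[OF fin\<rho>]
  let ?c = "\<lambda>i. of_bool ((i, k) \<in> E)"
  have lnm: "ln (1 - 2 * \<epsilon>) + ln (1 + 2 * \<epsilon>) = ln (1 - 4 * \<epsilon>\<^sup>2)"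
    using \<epsilon> by (subst ln_mult_pos[symmetric]) (auto simp: power2_eq_square algebra_simps)
  have step: "measure_pmf.expectation (coin \<rho> k (1/2))
      (\<lambda>x. ln (likelihood_ratio \<epsilon> k (h @ [(i, observe E x i)]))) =
      ln (likelihood_ratio \<epsilon> k h) + ln (1 - 4 * \<epsilon>\<^sup>2) / 2 * ?c i" for h i
  proof -
    have "measure_pmf.expectation (coin \<rho> k (1/2))
      (\<lambda>x. ln (likelihood_ratio \<epsilon> k (h @ [(i, observe E x i)]))) =
      measure_pmf.expectation (coin \<rho> k (1/2))
      (\<lambda>x. ln (likelihood_ratio \<epsilon> k h) + ln (round_ratio \<epsilon> k (observe E x i)))"
      using \<epsilon> likelihood_ratio_pos[of \<epsilon> k h] round_ratio_pos[of \<epsilon> k] by (simp add: ln_mult_pos)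
    then show ?thesis using fin\<rho> \<epsilon>
      by (auto simp: expectation_coin round_ratio_observe lnm[symmetric] add_divide_distrib)
  qed
  have "measure_pmf.expectation (fair (Suc t)) (\<lambda>h. ln (likelihood_ratio \<epsilon> k h)) =
    measure_pmf.expectation (fair t) (\<lambda>h. measure_pmf.expectation (s h)
      (\<lambda>i. measure_pmf.expectation (coin \<rho> k (1/2))
      (\<lambda>x. ln (likelihood_ratio \<epsilon> k (h @ [(i, observe E x i)])))))"
    using fin by (simp add: expectation_bind_finite del: likelihood_ratio_simps)
  also have "\<dots> = measure_pmf.expectation (fair t) (\<lambda>h. ln (likelihood_ratio \<epsilon> k h)) +
      ln (1 - 4 * \<epsilon>\<^sup>2) / 2 * measure_pmf.expectation (fair t) (\<lambda>h. measure_pmf.expectation (s h) ?c)"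
    unfolding step using fin by (simp add: expectation_add)
  also have "measure_pmf.expectation (fair t) (\<lambda>h. ln (likelihood_ratio \<epsilon> k h)) =
      ln (1 - 4 * \<epsilon>\<^sup>2) / 2 * measure_pmf.expectation (fair t) (total ?c)"
    by (rule Suc.IH)
  also have "ln (1 - 4 * \<epsilon>\<^sup>2) / 2 * measure_pmf.expectation (fair t) (total ?c) +
      ln (1 - 4 * \<epsilon>\<^sup>2) / 2 * measure_pmf.expectation (fair t) (\<lambda>h. measure_pmf.expectation (s h) ?c) =
      ln (1 - 4 * \<epsilon>\<^sup>2) / 2 * measure_pmf.expectation (fair (Suc t)) (total ?c)"
    using fin by (simp add: expectation_total[OF s] distrib_left del: iid_dist.simps)
  finally show ?case .
qed simp

text \<open>The square root of Pinsker's inequality is traded for a free parameter \<kappa>, so the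
  bound is linear in the expected number of observations and can be summed over many
  \<open>k\<close>. It is used with \<open>\<kappa> = 8\<close>.\<close>

lemma expectation_biased_le:
  assumes f: "\<And>h. h \<in> set_pmf (fair t) \<Longrightarrow> 0 \<le> f h \<and> f h \<le> M" and "0 \<le> M" "0 < \<kappa>"
  shows "measure_pmf.expectation (biased t) f \<le> measure_pmf.expectation (fair t) f +
    M * (\<kappa> * \<epsilon>\<^sup>2 * measure_pmf.expectation (fair t) (total (\<lambda>i. of_bool ((i, k) \<in> E))) + 1 / \<kappa>)"
proof -
  let ?L = "likelihood_ratio \<epsilon> k" and ?c = "\<lambda>i. of_bool ((i, k) \<in> E)"
  note fin = finite_coin_dists(1)[of t]
  have Lpos: "0 < ?L h" for h using likelihood_ratio_pos \<epsilon> by simp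
  have EL: "measure_pmf.expectation (fair t) ?L = 1"
    using change_of_measure[of t "\<lambda>_. 1"] by simp
  define D where "D = - measure_pmf.expectation (fair t) (\<lambda>h. ln (?L h))"
  have Z0: "0 \<le> measure_pmf.expectation (fair t) (total ?c)"
    by (intro Bochner_Integration.integral_nonneg total_nonneg) auto
  have D: "D \<le> 4 * \<epsilon>\<^sup>2 * measure_pmf.expectation (fair t) (total ?c)"
  proof -
    have e2: "4 * \<epsilon>\<^sup>2 \<le> 1/2" "0 \<le> 4 * \<epsilon>\<^sup>2"
      using \<epsilon> power_mono[of \<epsilon> "1/4" 2] by (auto simp: power2_eq_square)
    have "- (4 * \<epsilon>\<^sup>2) - 2 * (4 * \<epsilon>\<^sup>2)\<^sup>2 \<le> ln (1 - 4 * \<epsilon>\<^sup>2)"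
      using e2 by (intro ln_one_minus_pos_lower_bound) auto
    moreover have "(4 * \<epsilon>\<^sup>2)\<^sup>2 \<le> (4 * \<epsilon>\<^sup>2) * (1/2)"
      unfolding power2_eq_square[of "4 * \<epsilon>\<^sup>2"] using e2 by (intro mult_left_mono)
    ultimately have "- ln (1 - 4 * \<epsilon>\<^sup>2) / 2 \<le> 4 * \<epsilon>\<^sup>2" by linarith
    then have "- ln (1 - 4 * \<epsilon>\<^sup>2) / 2 * measure_pmf.expectation (fair t) (total ?c) \<le>
      4 * \<epsilon>\<^sup>2 * measure_pmf.expectation (fair t) (total ?c)"
      using Z0 by (intro mult_right_mono)
    then show ?thesis unfolding D_def expectation_ln_likelihood_ratio by simp
  qed
  \<comment> \<open>A Pinsker-type bound: AM-GM on \<open>|L - 1| = |sqrt L - 1| (sqrt L + 1)\<close>, together with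
    \<open>ln L \<le> 2 (sqrt L - 1)\<close>.\<close>
  have point: "(?L h - 1) * f h \<le>
      M * (\<kappa> / 4 * (?L h - 1 - ln (?L h)) + (1 + ?L h) / (2 * \<kappa>)) + M / 2 * (?L h - 1)"
    if h: "h \<in> set_pmf (fair t)" for h
  proof -
    define r where "r = sqrt (?L h)"
    have r: "0 < r" "r * r = ?L h" using Lpos[of h] by (auto simp: r_def)
    have "ln (?L h) = 2 * ln r" using r by (metis ln_mult_pos mult_2)
    then have lnL: "ln (?L h) \<le> 2 * (r - 1)" using ln_le_minus_one[OF r(1)] by simp
    \<comment> \<open>Only the positive part of \<open>?L h - 1\<close> matters. It is half of the
      absolute value plus half of \<open>?L h - 1\<close>, and the latter has mean 0 under the fair
      law.\<close>
    have gain: "(?L h - 1) * f h \<le> M * ((\<bar>?L h - 1\<bar> + (?L h - 1)) / 2)"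
    proof (cases "1 \<le> ?L h")
      case True
      then show ?thesis using f[OF h] mult_left_mono[of "f h" M "?L h - 1"] by (simp add: algebra_simps)
    next
      case False
      then show ?thesis using f[OF h] by (simp add: mult_nonpos_nonneg)
    qed
    moreover have "\<bar>?L h - 1\<bar> \<le> \<kappa> / 2 * (?L h - 1 - ln (?L h)) + 1 / (2 * \<kappa>) * (2 * (1 + ?L h))"
    proof -
      have "\<bar>?L h - 1\<bar> \<le> \<kappa> / 2 * (r - 1)\<^sup>2 + 1 / (2 * \<kappa>) * (r + 1)\<^sup>2"
      proof -
        have "0 \<le> (\<kappa> * \<bar>r - 1\<bar> - (r + 1))\<^sup>2" by simp
        then have "2 * \<kappa> * (\<bar>r - 1\<bar> * (r + 1)) \<le> \<kappa>\<^sup>2 * (r - 1)\<^sup>2 + (r + 1)\<^sup>2"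
          by (simp add: power2_eq_square algebra_simps)
        moreover have "\<bar>r - 1\<bar> * (r + 1) = \<bar>(r - 1) * (r + 1)\<bar>"
          using r(1) by (simp add: abs_mult)
        moreover have "(r - 1) * (r + 1) = ?L h - 1"
          using r(2) by (simp add: algebra_simps)
        ultimately have "2 * \<kappa> * \<bar>?L h - 1\<bar> \<le> \<kappa>\<^sup>2 * (r - 1)\<^sup>2 + (r + 1)\<^sup>2" by simp
        then show ?thesis using assms(3) by (simp add: field_simps power2_eq_square)
      qed
    moreover have "\<kappa> / 2 * (r - 1)\<^sup>2 \<le> \<kappa> / 2 * (?L h - 1 - ln (?L h))"
      using lnL r(2) assms(3) by (intro mult_left_mono) (simp_all add: power2_eq_square algebra_simps)
    moreover have "1 / (2 * \<kappa>) * (r + 1)\<^sup>2 \<le> 1 / (2 * \<kappa>) * (2 * (1 + ?L h))"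
      using sum_squares_bound[of r 1] r(2) assms(3)
      by (intro mult_left_mono) (simp_all add: power2_eq_square algebra_simps)
    ultimately show ?thesis by linarith
    qed
    then have "M * ((\<bar>?L h - 1\<bar> + (?L h - 1)) / 2) \<le>
        M * ((\<kappa> / 2 * (?L h - 1 - ln (?L h)) + 1 / (2 * \<kappa>) * (2 * (1 + ?L h)) + (?L h - 1)) / 2)"
      using assms(2) by (intro mult_left_mono divide_right_mono add_right_mono) auto
    also have "\<dots> = M * (\<kappa> / 4 * (?L h - 1 - ln (?L h)) + (1 + ?L h) / (2 * \<kappa>)) + M / 2 * (?L h - 1)"
      using assms(3) by (simp add: field_simps)
    finally show ?thesis using gain by linarith
  qed
  have "measure_pmf.expectation (biased t) f - measure_pmf.expectation (fair t) f =
      measure_pmf.expectation (fair t) (\<lambda>h. (?L h - 1) * f h)"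
    unfolding change_of_measure by (simp add: left_diff_distrib expectation_diff[OF fin])
  also have "\<dots> \<le> measure_pmf.expectation (fair t)
    (\<lambda>h. M * (\<kappa> / 4 * (?L h - 1 - ln (?L h)) + (1 + ?L h) / (2 * \<kappa>)) + M / 2 * (?L h - 1))"
    by (intro expectation_mono fin point)
  also have "\<dots> = M * (\<kappa> / 4 * D + 1 / \<kappa>)"
    by (simp add: expectation_add[OF fin] expectation_diff[OF fin] EL D_def)
  also have "\<dots> \<le> M * (\<kappa> / 4 * (4 * \<epsilon>\<^sup>2 * measure_pmf.expectation (fair t) (total ?c)) + 1 / \<kappa>)"
    using D assms by (intro mult_left_mono add_right_mono) auto
  finally show ?thesis by (simp add: mult_ac)
qed

end

text \<open>With all coins of \<open>U\<close> fair, each play outside \<open>U\<close> loses 1/2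
  against \<open>U\<close>, so at most \<open>2 * R\<close> of them are expected, and the coins are
  seen at most \<open>a * T + 2 * d * R\<close> times in total. By \<open>small\<close> an average
  coin is seen at most \<open>1 / (64 * \<epsilon>\<^sup>2)\<close> times, too rarely to be found
  when it is the biased one.\<close>

lemma regret_lower_bound_many:
  fixes a d :: real
  assumes s: "valid_strategy K s" and U: "U \<subseteq> {..<K}" "2 \<le> card U" and \<epsilon>: "0 < \<epsilon>" "\<epsilon> \<le> 1/4"
    and inside: "\<And>i. i \<in> U \<Longrightarrow> card {k\<in>U. (i, k) \<in> E} \<le> a"
    and outside: "\<And>i. i < K \<Longrightarrow> i \<notin> U \<Longrightarrow> card {k\<in>U. (i, k) \<in> E} \<le> d"
    and R: "\<And>l. valid_losses l \<Longrightarrow> expected_regret K E s l T \<le> R"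
    and small: "a * T + 2 * d * R \<le> card U / (64 * \<epsilon>\<^sup>2)" and ad: "0 \<le> a" "0 \<le> d"
  shows "\<epsilon> * T / 4 \<le> R"
proof -
  have finU: "finite U" using U(1) by (rule finite_subset) simp
  define \<beta> :: "real pmf" where "\<beta> = map_pmf of_bool (bernoulli_pmf (1/2))"
  define \<nu> where "\<nu> = Pi_pmf U 1 (\<lambda>_. \<beta>)"
  define \<rho> where "\<rho> k = Pi_pmf (U - {k}) 1 (\<lambda>_. \<beta>)" for k
  define b :: "nat \<Rightarrow> real" where "b i = (if i \<in> U then 1/2 else 1)" for i
  define Z :: "nat \<Rightarrow> nat \<Rightarrow> real" where "Z k i = of_bool ((i, k) \<in> E)" for k i
  have fin\<beta>: "finite (set_pmf \<beta>)" and set\<beta>: "set_pmf \<beta> \<subseteq> {0, 1}" by (auto simp: \<beta>_def)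
  have E\<beta>: "measure_pmf.expectation \<beta> (\<lambda>x. x) = 1/2" by (simp add: \<beta>_def)
  have fin\<rho>: "finite (set_pmf (\<rho> k))" for k
    unfolding \<rho>_def using finU fin\<beta> by (subst set_Pi_pmf) (auto intro!: finite_PiE_dflt)
  \<comment> \<open>The fair law is the same for every \<open>k\<close>, so all biased games are
    compared with one reference game.\<close>
  have \<nu>_coin: "\<nu> = coin (\<rho> k) k (1/2)" if "k \<in> U" for k
  proof -
    have "\<nu> = Pi_pmf (insert k (U - {k})) 1 (\<lambda>_. \<beta>)"
      using that by (simp add: \<nu>_def insert_absorb)
    then show ?thesis unfolding coin_def \<rho>_def \<beta>_def using finU
      by (subst (asm) Pi_pmf_insert') (auto simp: map_pmf_def bind_assoc_pmf bind_return_pmf)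
  qed
  have fin\<nu>: "finite (set_pmf \<nu>)"
    unfolding \<nu>_def using finU fin\<beta> by (subst set_Pi_pmf) (auto intro!: finite_PiE_dflt)
  have component: "measure_pmf.expectation (Pi_pmf X 1 (\<lambda>_. \<beta>)) (\<lambda>x. x i) = (if i \<in> X then 1/2 else 1)"
    if "finite X" for X i
  proof -
    have "measure_pmf.expectation (Pi_pmf X 1 (\<lambda>_. \<beta>)) (\<lambda>x. x i) =
        measure_pmf.expectation (map_pmf (\<lambda>x. x i) (Pi_pmf X 1 (\<lambda>_. \<beta>))) (\<lambda>x. x)" by simp
    then show ?thesis using that by (simp add: Pi_pmf_component E\<beta> del: integral_map_pmf)
  qed
  have valid: "0 \<le> x i \<and> x i \<le> 1" if "finite X" "x \<in> set_pmf (Pi_pmf X 1 (\<lambda>_. \<beta>))" for x X i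
    using that set\<beta> by (cases "i \<in> X") (auto simp: set_Pi_pmf PiE_dflt_def)
  note finI = finite_iid_dist[OF s fin\<nu>]
  let ?E = "measure_pmf.expectation (iid_dist E s \<nu> T)"
  obtain k0 where k0: "k0 \<in> U" using U(2) by fastforce
  have "?E (total (\<lambda>i. b i - b k0)) \<le> R"
    using regret_bound_ge_pseudo_regret[OF s _ fin\<nu> _ R, of k0] k0 U(1) component[OF finU] valid[OF finU]
    unfolding \<nu>_def[symmetric] b_def by (auto simp: subset_iff)
  moreover have "?E (total (\<lambda>i. b i - b k0)) = ?E (total (\<lambda>i. of_bool (i \<notin> U))) / 2"
  proof -
    have "total (\<lambda>i. b i - b k0) h = total (\<lambda>i. of_bool (i \<notin> U)) h / 2" for h
      using k0 by (induction h rule: rev_induct) (auto simp: b_def add_divide_distrib)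
    then have "total (\<lambda>i. b i - b k0) = (\<lambda>h. total (\<lambda>i. of_bool (i \<notin> U)) h / 2)" by blast
    then show ?thesis by simp
  qed
  ultimately have out: "?E (total (\<lambda>i. of_bool (i \<notin> U))) \<le> 2 * R" by simp
  have T: "?E (\<lambda>h. real (length h)) = T"
    using iid_dist_support(1)[OF s] by (subst expectation_cong[where g="\<lambda>_. real T"]) auto
  have one: "\<epsilon> * (real T - ?E (total (\<lambda>i. of_bool (i = k))) - T * (8 * \<epsilon>\<^sup>2 * ?E (total (Z k)) + 1/8)) \<le> R"
    if k: "k \<in> U" for k
  proof -
    let ?\<nu>' = "coin (\<rho> k) k (1/2 - \<epsilon>)"
    let ?E' = "measure_pmf.expectation (iid_dist E s ?\<nu>' T)"
    have fin\<nu>': "finite (set_pmf ?\<nu>')" using finite_set_coin[OF fin\<rho>] .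
    have valid': "0 \<le> x i \<and> x i \<le> 1" if "x \<in> set_pmf ?\<nu>'" for x i
      using that valid[of "U - {k}" _ i] finU by (auto simp: coin_def \<rho>_def)
    have mean: "measure_pmf.expectation ?\<nu>' (\<lambda>x. x i) = (if i = k then 1/2 - \<epsilon> else b i)" for i
      using \<epsilon> component[of "U - {k}" i] finU fin\<rho>[of k]
      by (simp add: expectation_coin_coordinate \<rho>_def b_def)
    have "\<epsilon> * (real T - ?E' (total (\<lambda>i. of_bool (i = k)))) =
        ?E' (\<lambda>h. \<epsilon> * (real (length h) - total (\<lambda>i. of_bool (i = k)) h))"
    proof -
      have "?E' (\<lambda>h. real (length h)) = T"
        using iid_dist_support(1)[OF s] by (subst expectation_cong[where g="\<lambda>_. real T"]) auto
      then show ?thesis by (simp add: expectation_diff[OF finite_iid_dist[OF s fin\<nu>']])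
    qed
    \<comment> \<open>In the biased game every action other than \<open>k\<close> is worse than
      \<open>k\<close> by at least \<epsilon>.\<close>
    also have "\<dots> \<le> ?E' (total (\<lambda>i. measure_pmf.expectation ?\<nu>' (\<lambda>x. x i) - measure_pmf.expectation ?\<nu>' (\<lambda>x. x k)))"
    proof (intro expectation_mono finite_iid_dist[OF s fin\<nu>'])
      fix h
      show "\<epsilon> * (real (length h) - total (\<lambda>i. of_bool (i = k)) h) \<le>
        total (\<lambda>i. measure_pmf.expectation ?\<nu>' (\<lambda>x. x i) - measure_pmf.expectation ?\<nu>' (\<lambda>x. x k)) h"
        unfolding mean using \<epsilon>
        by (induction h rule: rev_induct) (auto simp: b_def algebra_simps)
    qed
    also have "\<dots> \<le> R"
      using regret_bound_ge_pseudo_regret[OF s _ fin\<nu>' _ R, of k] k U(1) valid' by auto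
    finally have A: "\<epsilon> * (real T - ?E' (total (\<lambda>i. of_bool (i = k)))) \<le> R" .
    have bnd: "0 \<le> total (\<lambda>i. of_bool (i = k)) h \<and> total (\<lambda>i. of_bool (i = k)) h \<le> real (length h)" for h
      by (induction h rule: rev_induct) auto
    have "?E' (total (\<lambda>i. of_bool (i = k))) \<le> ?E (total (\<lambda>i. of_bool (i = k))) +
        T * (8 * \<epsilon>\<^sup>2 * ?E (total (Z k)) + 1 / 8)"
      using expectation_biased_le[OF s fin\<rho>[of k], of \<epsilon> E k T "total (\<lambda>i. of_bool (i = k))" "real T" 8] \<epsilon>
        bnd iid_dist_support(1)[OF s] unfolding Z_def by (metis \<nu>_coin[OF k] less_imp_le of_nat_0_le_iff zero_less_numeral)
    then have "\<epsilon> * (real T - ?E (total (\<lambda>i. of_bool (i = k))) - T * (8 * \<epsilon>\<^sup>2 * ?E (total (Z k)) + 1/8)) \<le>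
        \<epsilon> * (real T - ?E' (total (\<lambda>i. of_bool (i = k))))"
      using \<epsilon> by (intro mult_left_mono) auto
    then show ?thesis using A by linarith
  qed
  have total_sum: "(\<Sum>k\<in>U. total (c k) h) = total (\<lambda>i. \<Sum>k\<in>U. c k i) h" for c h
    by (induction h rule: rev_induct) (auto simp: sum.distrib)
  have NU: "(\<Sum>k\<in>U. ?E (total (\<lambda>i. of_bool (i = k)))) \<le> T"
  proof -
    have "(\<Sum>k\<in>U. ?E (total (\<lambda>i. of_bool (i = k)))) = ?E (\<lambda>h. total (\<lambda>i. \<Sum>k\<in>U. of_bool (i = k)) h)"
      by (simp add: expectation_sum[OF finI, symmetric] total_sum)
    also have "\<dots> \<le> ?E (\<lambda>h. real (length h))"
    proof (intro expectation_mono finI)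
      fix h :: history
      show "total (\<lambda>i. \<Sum>k\<in>U. of_bool (i = k)) h \<le> real (length h)"
        using finU by (induction h rule: rev_induct) (auto simp: of_bool_def)
    qed
    finally show ?thesis using T by simp
  qed
  have ZU: "(\<Sum>k\<in>U. ?E (total (Z k))) \<le> a * T + 2 * d * R"
  proof -
    have "(\<Sum>k\<in>U. ?E (total (Z k))) = ?E (\<lambda>h. total (\<lambda>i. \<Sum>k\<in>U. Z k i) h)"
      by (simp add: expectation_sum[OF finI, symmetric] total_sum)
    also have "\<dots> \<le> ?E (\<lambda>h. a * length h + d * total (\<lambda>i. of_bool (i \<notin> U)) h)"
    proof (intro expectation_mono finI)
      fix h assume "h \<in> set_pmf (iid_dist E s \<nu> T)"
      then have "fst ` set h \<subseteq> {..<K}" by (rule iid_dist_support(2)[OF s])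
      then show "total (\<lambda>i. \<Sum>k\<in>U. Z k i) h \<le> a * length h + d * total (\<lambda>i. of_bool (i \<notin> U)) h"
      proof (induction h rule: rev_induct)
        case (snoc z h)
        have "(\<Sum>k\<in>U. Z k (fst z)) = card {k\<in>U. (fst z, k) \<in> E}"
          unfolding Z_def using finU by (simp add: of_bool_def sum.If_cases Int_def conj_commute)
        also have "\<dots> \<le> a + d * of_bool (fst z \<notin> U)"
          using inside[of "fst z"] outside[of "fst z"] snoc.prems ad by (cases "fst z \<in> U") auto
        finally show ?case using snoc by (simp add: algebra_simps)
      qed simp
    qed
    also have "\<dots> = a * T + d * ?E (total (\<lambda>i. of_bool (i \<notin> U)))"
      by (simp add: expectation_add[OF finI] T)
    finally show ?thesis using mult_left_mono[OF out ad(2)] by linarith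
  qed
  define m where "m = real (card U)"
  have m: "2 \<le> m" using U(2) by (simp add: m_def)
  define N where "N = (\<Sum>k\<in>U. ?E (total (\<lambda>i. of_bool (i = k))))"
  define z where "z = (\<Sum>k\<in>U. ?E (total (Z k)))"
  have "(\<Sum>k\<in>U. \<epsilon> * (real T - ?E (total (\<lambda>i. of_bool (i = k))) - T * (8 * \<epsilon>\<^sup>2 * ?E (total (Z k)) + 1/8)))
    \<le> (\<Sum>k\<in>U. R)" by (intro sum_mono one)
  also have "(\<Sum>k\<in>U. \<epsilon> * (real T - ?E (total (\<lambda>i. of_bool (i = k))) - T * (8 * \<epsilon>\<^sup>2 * ?E (total (Z k)) + 1/8)))
    = \<epsilon> * (m * T - N - T * (8 * \<epsilon>\<^sup>2 * z + m / 8))"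
    by (simp add: sum_distrib_left sum_subtractf sum.distrib m_def N_def z_def algebra_simps)
  finally have up: "\<epsilon> * (m * T - N - T * (8 * \<epsilon>\<^sup>2 * z + m / 8)) \<le> m * R" by (simp add: m_def)
  \<comment> \<open>The entropy term and the \<open>1/8\<close> from \<open>\<kappa> = 8\<close>
    each cost \<open>m / 8\<close> per round. The plays of coins sum to at most \<open>T\<close>,
    hence to at most half of \<open>m * T\<close>, because there are two coins or more.\<close>
  have "8 * \<epsilon>\<^sup>2 * z \<le> 8 * \<epsilon>\<^sup>2 * (m / (64 * \<epsilon>\<^sup>2))"
    using ZU small unfolding z_def m_def by (intro mult_left_mono) auto
  also have "\<dots> = m / 8" using \<epsilon> by simp
  finally have "T * (8 * \<epsilon>\<^sup>2 * z + m / 8) \<le> T * (m / 4)"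
    by (intro mult_left_mono) auto
  moreover have "1 * real T \<le> m / 2 * T" using m by (intro mult_right_mono) auto
  ultimately have "m * T / 4 \<le> m * T - N - T * (8 * \<epsilon>\<^sup>2 * z + m / 8)"
    using NU unfolding N_def[symmetric] by (simp add: mult.commute)
  then have "\<epsilon> * (m * T / 4) \<le> \<epsilon> * (m * T - N - T * (8 * \<epsilon>\<^sup>2 * z + m / 8))"
    using \<epsilon> by (intro mult_left_mono) auto
  also note up
  finally have "m * (\<epsilon> * T / 4) \<le> m * R" by (simp add: mult_ac)
  then show ?thesis using m by simp
qed

text \<open>In effect two actions: \<open>j\<close> always loses
  \<open>1/2 - \<epsilon> / 2\<close>, and the coin \<open>w\<close> is worse than \<open>j\<close>
  by \<open>\<epsilon> / 2\<close> when fair and better by as much when biased. Neither of them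
  reveals \<open>w\<close>, and all others lose 1, so a look at the coin costs at least 1/2 and at
  most \<open>2 * R\<close> looks are expected under the fair coin.\<close>

lemma regret_lower_bound_single:
  assumes s: "valid_strategy K s" and w: "w < K" "j < K" "w \<noteq> j" "(w, w) \<notin> E" "(j, w) \<notin> E"
    and \<epsilon>: "0 < \<epsilon>" "\<epsilon> \<le> 1/4"
    and R: "\<And>l. valid_losses l \<Longrightarrow> expected_regret K E s l T \<le> R"
    and small: "2 * R \<le> 1 / (64 * \<epsilon>\<^sup>2)"
  shows "\<epsilon> * T * (3/16) \<le> R"
proof -
  define \<rho> :: "(nat \<Rightarrow> real) pmf" where "\<rho> = return_pmf (\<lambda>i. if i = j then 1/2 - \<epsilon> / 2 else 1)"
  have fin\<rho>: "finite (set_pmf \<rho>)" by (simp add: \<rho>_def)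
  have fin: "finite (set_pmf (coin \<rho> w q))" for q using finite_set_coin[OF fin\<rho>] .
  note finI = finite_iid_dist[OF s fin]
  have valid: "0 \<le> x i \<and> x i \<le> 1" if "x \<in> set_pmf (coin \<rho> w q)" for x i q
    using that \<epsilon> by (auto simp: coin_def \<rho>_def)
  have mean: "measure_pmf.expectation (coin \<rho> w q) (\<lambda>x. x i) =
      (if i = w then q else if i = j then 1/2 - \<epsilon> / 2 else 1)" if "0 \<le> q" "q \<le> 1" for i q
    using expectation_coin_coordinate[OF fin\<rho> that] by (simp add: \<rho>_def)
  let ?q = "1/2 - \<epsilon>"
  let ?E = "measure_pmf.expectation (iid_dist E s (coin \<rho> w (1/2)) T)"
  let ?E' = "measure_pmf.expectation (iid_dist E s (coin \<rho> w ?q) T)"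
  let ?N = "total (\<lambda>i. of_bool (i = w))" and ?Z = "total (\<lambda>i. of_bool ((i, w) \<in> E))"
  have len: "?E' (\<lambda>h. real (length h)) = T"
    using iid_dist_support(1)[OF s] by (subst expectation_cong[where g="\<lambda>_. real T"]) auto
  have "\<epsilon> / 2 * ?E ?N + ?E ?Z / 2 = ?E (\<lambda>h. \<epsilon> / 2 * ?N h + ?Z h / 2)"
    by (simp add: expectation_add[OF finI])
  also have "\<dots> \<le> ?E (total (\<lambda>i. measure_pmf.expectation (coin \<rho> w (1/2)) (\<lambda>x. x i) -
      measure_pmf.expectation (coin \<rho> w (1/2)) (\<lambda>x. x j)))"
  proof (intro expectation_mono finI)
    fix h
    show "\<epsilon> / 2 * ?N h + ?Z h / 2 \<le> total (\<lambda>i. measure_pmf.expectation (coin \<rho> w (1/2)) (\<lambda>x. x i) -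
      measure_pmf.expectation (coin \<rho> w (1/2)) (\<lambda>x. x j)) h"
      using w \<epsilon> by (induction h rule: rev_induct) (auto simp: mean of_bool_def algebra_simps add_divide_distrib)
  qed
  also have "\<dots> \<le> R"
    using regret_bound_ge_pseudo_regret[OF s w(2) fin _ R] valid by blast
  finally have fair_bound: "\<epsilon> / 2 * ?E ?N + ?E ?Z / 2 \<le> R" .
  have "\<epsilon> / 2 * (real T - ?E' ?N) = ?E' (\<lambda>h. \<epsilon> / 2 * (real (length h) - ?N h))"
    by (simp add: expectation_diff[OF finI] len)
  also have "\<dots> \<le> ?E' (total (\<lambda>i. measure_pmf.expectation (coin \<rho> w ?q) (\<lambda>x. x i) -
      measure_pmf.expectation (coin \<rho> w ?q) (\<lambda>x. x w)))"
  proof (intro expectation_mono finI)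
    fix h
    show "\<epsilon> / 2 * (real (length h) - ?N h) \<le> total (\<lambda>i. measure_pmf.expectation (coin \<rho> w ?q) (\<lambda>x. x i) -
      measure_pmf.expectation (coin \<rho> w ?q) (\<lambda>x. x w)) h"
      using w \<epsilon> by (induction h rule: rev_induct) (auto simp: mean of_bool_def algebra_simps add_divide_distrib)
  qed
  also have "\<dots> \<le> R"
    using regret_bound_ge_pseudo_regret[OF s w(1) fin _ R] valid by blast
  finally have biased_bound: "\<epsilon> / 2 * (real T - ?E' ?N) \<le> R" .
  have nonneg: "0 \<le> ?E ?N" "0 \<le> ?E ?Z"
    by (intro Bochner_Integration.integral_nonneg total_nonneg; simp)+
  have N: "0 \<le> ?N h \<and> ?N h \<le> real (length h)" for h
    by (induction h rule: rev_induct) auto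
  have "?E' ?N \<le> ?E ?N + T * (8 * \<epsilon>\<^sup>2 * ?E ?Z + 1 / 8)"
    using expectation_biased_le[OF s fin\<rho>, of \<epsilon> E w T ?N "real T" 8] \<epsilon> N iid_dist_support(1)[OF s]
    by (metis less_imp_le of_nat_0_le_iff zero_less_numeral)
  moreover have "T * (8 * \<epsilon>\<^sup>2 * ?E ?Z + 1 / 8) \<le> T * (1 / 4)"
  proof (intro mult_left_mono)
    have "0 \<le> \<epsilon> / 2 * ?E ?N" using \<epsilon> nonneg by simp
    then have "?E ?Z \<le> 1 / (64 * \<epsilon>\<^sup>2)" using fair_bound small by linarith
    then have "8 * \<epsilon>\<^sup>2 * ?E ?Z \<le> 8 * \<epsilon>\<^sup>2 * (1 / (64 * \<epsilon>\<^sup>2))" by (intro mult_left_mono) auto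
    then show "8 * \<epsilon>\<^sup>2 * ?E ?Z + 1 / 8 \<le> 1 / 4" using \<epsilon> by simp
  qed simp
  ultimately have "real T - T / 4 - ?E ?N \<le> real T - ?E' ?N" by simp
  then have "\<epsilon> / 2 * (real T - T / 4 - ?E ?N) \<le> \<epsilon> / 2 * (real T - ?E' ?N)"
    using \<epsilon> by (intro mult_left_mono) auto
  \<comment> \<open>Plays of \<open>w\<close> are paid for in the fair game, missing plays of
    \<open>w\<close> in the biased one; the two bounds are added.\<close>
  then have "\<epsilon> / 2 * (3 / 4 * T) \<le> R + \<epsilon> / 2 * ?E ?N"
    using biased_bound by (simp add: algebra_simps)
  then show ?thesis using fair_bound nonneg by simp
qed

section \<open>Exponential weights with graph feedback\<close>

text \<open>The range is one-sided because shifted estimates may be arbitrarily large but are kept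
  above -1 after scaling by \<eta>.\<close>

lemma exp_minus_le_quadratic:
  fixes y :: real
  assumes "- 1 \<le> y"
  shows "exp (- y) \<le> 1 - y + y\<^sup>2"
proof (cases "0 \<le> y")
  case True
  have "1 \<le> (1 - y + y\<^sup>2) * (1 + y + y\<^sup>2 / 2)"
  proof -
    have "(1 - y + y\<^sup>2) * (1 + y + y\<^sup>2 / 2) = 1 + (y\<^sup>2 + y ^ 3 + y ^ 4) / 2"
      by (simp add: power2_eq_square power3_eq_cube power4_eq_xxxx field_simps)
    then show ?thesis using True by simp
  qed
  also have "\<dots> \<le> (1 - y + y\<^sup>2) * exp y"
  proof (intro mult_left_mono)
    show "1 + y + y\<^sup>2 / 2 \<le> exp y" using exp_lower_Taylor_quadratic[OF True] .
    have "0 \<le> (1 - y)\<^sup>2 + y" using True by simp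
    then show "0 \<le> 1 - y + y\<^sup>2" using True by (simp add: power2_eq_square algebra_simps)
  qed
  finally show ?thesis by (simp add: exp_minus field_simps)
next
  case False
  then show ?thesis using exp_bound[of "- y"] assms by simp
qed

text \<open>\<eta> is the learning rate, \<gamma> the share of exploration and \<open>u\<close> the
  exploration distribution. Observability keeps the divisor \<open>P\<close> of the estimates
  positive.\<close>

locale exp3 =
  fixes K :: nat and E :: "(nat \<times> nat) set" and \<eta> \<gamma> :: real and u :: "nat \<Rightarrow> real"
  assumes K_pos: "0 < K" and eta_pos: "0 < \<eta>" and gamma: "0 \<le> \<gamma>" "\<gamma> < 1"
    and u_nonneg: "\<And>i. 0 \<le> u i" and u_sum: "sum u {..<K} = 1"
    and observable: "observable_graph K E"
begin

definition q :: "(nat \<Rightarrow> real) \<Rightarrow> nat \<Rightarrow> real" where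
  "q w i = w i / sum w {..<K}"

definition p :: "(nat \<Rightarrow> real) \<Rightarrow> nat \<Rightarrow> real" where
  "p w i = (1 - \<gamma>) * q w i + \<gamma> * u i"

definition P :: "(nat \<Rightarrow> real) \<Rightarrow> nat \<Rightarrow> real" where
  "P w j = (\<Sum>i\<in>{i\<in>{..<K}. (i, j) \<in> E}. p w i)"

definition estimate :: "(nat \<Rightarrow> real) \<Rightarrow> (nat \<Rightarrow> real option) \<Rightarrow> nat \<Rightarrow> real" where
  "estimate w ob j = (case ob j of None \<Rightarrow> 0 | Some v \<Rightarrow> v / P w j)"

definition update :: "(nat \<Rightarrow> real) \<Rightarrow> nat \<times> (nat \<Rightarrow> real option) \<Rightarrow> nat \<Rightarrow> real" where
  "update w z j = w j * exp (- \<eta> * estimate w (snd z) j)"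

definition weights :: "history \<Rightarrow> nat \<Rightarrow> real" where
  "weights h = foldl update (\<lambda>_. 1) h"

definition strat :: strategy where
  "strat h = embed_pmf (\<lambda>i. if i < K then p (weights h) i else 0)"

text \<open>This is \<open>- ln (q w k)\<close>. For \<open>k < K\<close> it starts at
  \<open>ln K\<close> and stays nonnegative; its decrease, divided by \<eta>, bounds the estimated
  regret against \<open>k\<close> up to second-moment terms.\<close>

definition potential :: "nat \<Rightarrow> (nat \<Rightarrow> real) \<Rightarrow> real" where
  "potential k w = ln (sum w {..<K}) - ln (w k)"

lemma estimate_observe:
  "estimate w (observe E x i) j = (if (i, j) \<in> E then x j / P w j else 0)"
  by (simp add: estimate_def observe_def)

lemma weights_simps [simp]: "weights [] = (\<lambda>_. 1)" "weights (h @ [z]) = update (weights h) z"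
  by (auto simp: weights_def)

lemma weights_pos: "0 < weights h i"
  by (induction h arbitrary: i rule: rev_induct) (auto simp: update_def)

context
  fixes w :: "nat \<Rightarrow> real"
  assumes w: "\<And>i. 0 < w i"
begin

lemma sum_w_pos: "0 < sum w {..<K}"
  using w K_pos by (intro sum_pos) auto

lemma q_pos: "0 < q w i"
  using w sum_w_pos by (simp add: q_def)

lemma q_sum: "sum (q w) {..<K} = 1"
  using sum_w_pos by (simp add: q_def flip: sum_divide_distrib)

lemma p_ge: "(1 - \<gamma>) * q w i \<le> p w i" "\<gamma> * u i \<le> p w i"
  using gamma u_nonneg q_pos[of i] by (auto simp: p_def less_imp_le)

lemma p_pos: "0 < p w i"
  by (rule less_le_trans[OF _ p_ge(1)]) (use q_pos gamma in simp)

lemma p_sum: "sum (p w) {..<K} = 1"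
proof -
  have "sum (p w) {..<K} = (1 - \<gamma>) * sum (q w) {..<K} + \<gamma> * sum u {..<K}"
    by (simp add: p_def sum.distrib sum_distrib_left)
  then show ?thesis by (simp add: q_sum u_sum)
qed

lemma p_le_P: "i < K \<Longrightarrow> (i, j) \<in> E \<Longrightarrow> p w i \<le> P w j"
  unfolding P_def using p_pos by (intro member_le_sum) (auto simp: less_imp_le)

lemma P_pos: "j < K \<Longrightarrow> 0 < P w j"
proof -
  assume "j < K"
  then obtain i where i: "i < K" "(i, j) \<in> E"
    using observable by (force simp: observable_graph_def observable_vertex_def in_nbrs_def)
  show ?thesis by (rule less_le_trans[OF p_pos p_le_P[OF i]])
qed

lemma estimate_unbiased:
  assumes "j < K"
  shows "(\<Sum>i<K. p w i * estimate w (observe E x i) j) = x j"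
proof -
  have "(\<Sum>i<K. p w i * estimate w (observe E x i) j) = (\<Sum>i<K. if (i, j) \<in> E then p w i * (x j / P w j) else 0)"
    by (intro sum.cong) (auto simp: estimate_observe)
  also have "\<dots> = P w j * (x j / P w j)"
    by (subst sum.inter_filter[symmetric]) (simp_all only: P_def sum_distrib_right finite_lessThan)
  finally show ?thesis using P_pos[OF assms] by simp
qed

lemma estimate_second_moment:
  assumes "j < K"
  shows "(\<Sum>i<K. p w i * (estimate w (observe E x i) j)\<^sup>2) = (x j)\<^sup>2 / P w j"
proof -
  have "(\<Sum>i<K. p w i * (estimate w (observe E x i) j)\<^sup>2) =
      (\<Sum>i<K. if (i, j) \<in> E then p w i * (x j / P w j)\<^sup>2 else 0)"
    by (intro sum.cong) (auto simp: estimate_observe)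
  also have "\<dots> = P w j * (x j / P w j)\<^sup>2"
    by (subst sum.inter_filter[symmetric]) (simp_all only: P_def sum_distrib_right finite_lessThan)
  finally show ?thesis using P_pos[OF assms] by (simp add: power2_eq_square)
qed

text \<open>Shifting all estimates by \<open>b\<close> multiplies all weights by one factor, which
  cancels in \<open>q\<close>; so \<open>b\<close> survives only in the range condition and in the
  second moment.\<close>

lemma potential_update:
  assumes "\<And>j. j < K \<Longrightarrow> - 1 \<le> \<eta> * (estimate w ob j - b)"
  shows "potential k (update w (i, ob)) \<le> potential k w - \<eta> * (\<Sum>j<K. q w j * estimate w ob j) +
    \<eta> * estimate w ob k + \<eta>\<^sup>2 * (\<Sum>j<K. q w j * (estimate w ob j - b)\<^sup>2)"
proof -
  define X where "X = estimate w ob"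
  define S where "S = sum w {..<K}"
  define A where "A = (\<Sum>j<K. q w j * exp (- \<eta> * (X j - b)))"
  have S: "0 < S" using sum_w_pos by (simp add: S_def)
  have A: "0 < A" unfolding A_def using K_pos q_pos by (intro sum_pos) auto
  have "sum (update w (i, ob)) {..<K} = S * (exp (- \<eta> * b) * A)"
  proof -
    have "update w (i, ob) j = S * (exp (- \<eta> * b) * (q w j * exp (- \<eta> * (X j - b))))" for j
      using S by (simp add: update_def q_def S_def X_def right_diff_distrib flip: exp_add mult.assoc)
    then show ?thesis by (simp add: A_def flip: sum_distrib_left)
  qed
  then have "ln (sum (update w (i, ob)) {..<K}) = ln S - \<eta> * b + ln A"
    using S A by (simp add: ln_mult_pos)
  moreover have "ln (update w (i, ob) k) = ln (w k) - \<eta> * X k"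
    using w by (simp add: update_def ln_mult_pos X_def)
  moreover have "ln A \<le> A - 1" using A by (rule ln_le_minus_one)
  moreover have "A \<le> (\<Sum>j<K. q w j * (1 - \<eta> * (X j - b) + (\<eta> * (X j - b))\<^sup>2))"
    unfolding A_def
  proof (intro sum_mono mult_left_mono)
    fix j assume "j \<in> {..<K}"
    then show "exp (- \<eta> * (X j - b)) \<le> 1 - \<eta> * (X j - b) + (\<eta> * (X j - b))\<^sup>2"
      using exp_minus_le_quadratic[of "\<eta> * (X j - b)"] assms by (simp add: X_def)
  qed (use q_pos in \<open>simp add: less_imp_le\<close>)
  moreover have "(\<Sum>j<K. q w j * (1 - \<eta> * (X j - b) + (\<eta> * (X j - b))\<^sup>2)) =
      1 + \<eta> * b - \<eta> * (\<Sum>j<K. q w j * X j) + \<eta>\<^sup>2 * (\<Sum>j<K. q w j * (X j - b)\<^sup>2)"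
  proof -
    have "q w j * (1 - \<eta> * (X j - b) + (\<eta> * (X j - b))\<^sup>2) =
        q w j * (1 + \<eta> * b) - \<eta> * (q w j * X j) + \<eta>\<^sup>2 * (q w j * (X j - b)\<^sup>2)" for j
      unfolding power_mult_distrib by (simp add: algebra_simps)
    then show ?thesis
      by (simp add: sum.distrib sum_subtractf q_sum flip: sum_distrib_left sum_distrib_right)
  qed
  ultimately show ?thesis by (simp add: potential_def S_def X_def)
qed

text \<open>Averaging over the played action turns the estimates into the true losses. The shift
  \<open>b i\<close> may depend on the played action \<open>i\<close>; mixing in \<open>u\<close>
  costs at most \<gamma> per round.\<close>

lemma expected_potential_update:
  assumes k: "k < K" and x: "\<And>i. 0 \<le> x i \<and> x i \<le> 1"
    and b: "\<And>i j. i < K \<Longrightarrow> j < K \<Longrightarrow> - 1 \<le> \<eta> * (estimate w (observe E x i) j - b i)"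
    and V: "(\<Sum>i<K. p w i * (\<Sum>j<K. q w j * (estimate w (observe E x i) j - b i)\<^sup>2)) \<le> V"
  shows "(\<Sum>i<K. p w i * potential k (update w (i, observe E x i))) +
    \<eta> * ((\<Sum>i<K. p w i * x i) - x k) \<le> potential k w + \<eta>\<^sup>2 * V + \<eta> * \<gamma>"
proof -
  let ?X = "\<lambda>i. estimate w (observe E x i)"
  have "(\<Sum>i<K. p w i * potential k (update w (i, observe E x i))) \<le>
    (\<Sum>i<K. p w i * (potential k w - \<eta> * (\<Sum>j<K. q w j * ?X i j) +
      \<eta> * ?X i k + \<eta>\<^sup>2 * (\<Sum>j<K. q w j * (?X i j - b i)\<^sup>2)))"
    using b p_pos by (intro sum_mono mult_left_mono potential_update) (auto simp: less_imp_le)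
  also have "\<dots> = potential k w - \<eta> * (\<Sum>i<K. \<Sum>j<K. p w i * (q w j * ?X i j)) +
      \<eta> * (\<Sum>i<K. p w i * ?X i k) + \<eta>\<^sup>2 * (\<Sum>i<K. p w i * (\<Sum>j<K. q w j * (?X i j - b i)\<^sup>2))"
  proof -
    have "p w i * (potential k w - \<eta> * (\<Sum>j<K. q w j * ?X i j) +
      \<eta> * ?X i k + \<eta>\<^sup>2 * (\<Sum>j<K. q w j * (?X i j - b i)\<^sup>2)) =
      p w i * potential k w - \<eta> * (\<Sum>j<K. p w i * (q w j * ?X i j)) +
      \<eta> * (p w i * ?X i k) + \<eta>\<^sup>2 * (p w i * (\<Sum>j<K. q w j * (?X i j - b i)\<^sup>2))" for i
      unfolding sum_distrib_left[of "p w i" "\<lambda>j. q w j * ?X i j", symmetric] by (simp only: algebra_simps)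
    then show ?thesis
      by (simp add: sum.distrib sum_subtractf p_sum flip: sum_distrib_left sum_distrib_right)
  qed
  also have "(\<Sum>i<K. \<Sum>j<K. p w i * (q w j * ?X i j)) = (\<Sum>j<K. q w j * (\<Sum>i<K. p w i * ?X i j))"
    by (subst sum.swap) (simp add: sum_distrib_left mult_ac)
  also have "\<dots> = (\<Sum>j<K. q w j * x j)"
    by (intro sum.cong refl) (simp add: estimate_unbiased)
  also have "(\<Sum>i<K. p w i * ?X i k) = x k"
    using k by (rule estimate_unbiased)
  finally have main: "(\<Sum>i<K. p w i * potential k (update w (i, observe E x i))) \<le>
    potential k w - \<eta> * (\<Sum>j<K. q w j * x j) + \<eta> * x k + \<eta>\<^sup>2 * V"
    using mult_left_mono[OF V, of "\<eta>\<^sup>2"] by simp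
  have "(\<Sum>i<K. p w i * x i) \<le> (\<Sum>i<K. q w i * x i + \<gamma> * u i)"
  proof (intro sum_mono)
    fix i
    have "p w i * x i = q w i * x i - \<gamma> * (q w i * x i) + \<gamma> * (u i * x i)"
      by (simp add: p_def algebra_simps)
    moreover have "0 \<le> \<gamma> * (q w i * x i)" using gamma q_pos[of i] x by (simp add: less_imp_le)
    moreover have "\<gamma> * (u i * x i) \<le> \<gamma> * u i"
      using gamma u_nonneg x by (intro mult_left_mono mult_left_le) auto
    ultimately show "p w i * x i \<le> q w i * x i + \<gamma> * u i" by linarith
  qed
  also have "\<dots> = (\<Sum>i<K. q w i * x i) + \<gamma>"
    by (simp add: sum.distrib u_sum flip: sum_distrib_left)
  finally have "\<eta> * (\<Sum>i<K. p w i * x i) \<le> \<eta> * ((\<Sum>i<K. q w i * x i) + \<gamma>)"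
    using eta_pos by (intro mult_left_mono) auto
  then show ?thesis using main by (simp add: algebra_simps)
qed

end

lemma pmf_strat: "pmf (strat h) i = (if i < K then p (weights h) i else 0)"
  unfolding strat_def
proof (rule pmf_embed_pmf)
  note p0 = less_imp_le[OF p_pos[of "weights h", OF weights_pos]]
  show "0 \<le> (if i < K then p (weights h) i else 0)" for i
    using p0 by simp
  have "(\<integral>\<^sup>+ i. ennreal (if i < K then p (weights h) i else 0) \<partial>count_space UNIV) =
      (\<Sum>i<K. ennreal (p (weights h) i))"
    by (subst nn_integral_count_space'[of "{..<K}"]) auto
  also have "\<dots> = ennreal (\<Sum>i<K. p (weights h) i)" using p0 by (simp add: sum_ennreal)
  finally show "(\<integral>\<^sup>+ i. ennreal (if i < K then p (weights h) i else 0) \<partial>count_space UNIV) = 1"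
    using p_sum[of "weights h", OF weights_pos] by simp
qed

lemma valid_strat: "valid_strategy K strat"
  by (auto simp: valid_strategy_def set_pmf_iff pmf_strat split: if_splits)

lemma expectation_strat: "measure_pmf.expectation (strat h) f = (\<Sum>i<K. p (weights h) i * f i)"
  using valid_strat by (subst integral_measure_pmf[of "{..<K}"]) (auto simp: valid_strategy_def pmf_strat)

text \<open>The potential inequality telescopes from \<open>ln K\<close> to a nonnegative value.
  What depends on the feedback graph is collected in the second-moment bound
  \<open>V\<close>.\<close>

theorem expected_regret_le:
  assumes V: "\<And>w x. (\<And>i. 0 < w i) \<Longrightarrow> (\<And>i. 0 \<le> x i \<and> x i \<le> 1) \<Longrightarrow>
      \<exists>b. (\<forall>i<K. \<forall>j<K. - 1 \<le> \<eta> * (estimate w (observe E x i) j - b i)) \<and>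
        (\<Sum>i<K. p w i * (\<Sum>j<K. q w j * (estimate w (observe E x i) j - b i)\<^sup>2)) \<le> V"
    and l: "valid_losses l"
  shows "expected_regret K E strat l T \<le> ln K / \<eta> + \<eta> * V * T + \<gamma> * T"
proof -
  have "Min ((\<lambda>i. \<Sum>t<T. l t i) ` {..<K}) \<in> (\<lambda>i. \<Sum>t<T. l t i) ` {..<K}"
    using K_pos by (intro Min_in) auto
  then obtain k where k: "k < K" "Min ((\<lambda>i. \<Sum>t<T. l t i) ` {..<K}) = (\<Sum>t<T. l t k)" by auto
  define G where "G t = measure_pmf.expectation (history_dist E strat l t)
    (\<lambda>h. measure_pmf.expectation (strat h) (l t))" for t
  let ?\<Phi> = "\<lambda>t. measure_pmf.expectation (history_dist E strat l t) (\<lambda>h. potential k (weights h))"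
  note finH = finite_history_dist[OF valid_strat] and finS = finite_set_valid_strategy[OF valid_strat]
  have step: "?\<Phi> (Suc t) + \<eta> * (G t - l t k) \<le> ?\<Phi> t + \<eta>\<^sup>2 * V + \<eta> * \<gamma>" for t
  proof -
    have "?\<Phi> (Suc t) + \<eta> * (G t - l t k) = measure_pmf.expectation (history_dist E strat l t)
      (\<lambda>h. (\<Sum>i<K. p (weights h) i * potential k (update (weights h) (i, observe E (l t) i))) +
        \<eta> * ((\<Sum>i<K. p (weights h) i * l t i) - l t k))"
      using finH finS by (simp add: expectation_bind_finite expectation_strat G_def
          expectation_add expectation_diff observation_eq)
    also have "\<dots> \<le> measure_pmf.expectation (history_dist E strat l t)
        (\<lambda>h. potential k (weights h) + \<eta>\<^sup>2 * V + \<eta> * \<gamma>)"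
    proof (intro expectation_mono finH)
      fix h
      have x: "\<And>i. 0 \<le> l t i \<and> l t i \<le> 1" using l by (simp add: valid_losses_def)
      obtain b where "\<forall>i<K. \<forall>j<K. - 1 \<le> \<eta> * (estimate (weights h) (observe E (l t) i) j - b i)"
        "(\<Sum>i<K. p (weights h) i * (\<Sum>j<K. q (weights h) j *
          (estimate (weights h) (observe E (l t) i) j - b i)\<^sup>2)) \<le> V"
        using V[of "weights h" "l t", OF weights_pos x] by (elim exE conjE) (rule that)
      then show "(\<Sum>i<K. p (weights h) i * potential k (update (weights h) (i, observe E (l t) i))) +
        \<eta> * ((\<Sum>i<K. p (weights h) i * l t i) - l t k) \<le> potential k (weights h) + \<eta>\<^sup>2 * V + \<eta> * \<gamma>"
        using k x by (intro expected_potential_update weights_pos) auto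
    qed
    also have "\<dots> = ?\<Phi> t + \<eta>\<^sup>2 * V + \<eta> * \<gamma>"
      using finH by (simp add: expectation_add)
    finally show ?thesis .
  qed
  have "?\<Phi> T + \<eta> * (\<Sum>t<T. G t - l t k) \<le> ln K + T * (\<eta>\<^sup>2 * V + \<eta> * \<gamma>)"
  proof (induction T)
    case 0
    then show ?case by (simp add: potential_def)
  next
    case (Suc T)
    then show ?case using step[of T] by (simp add: algebra_simps)
  qed
  moreover have "0 \<le> ?\<Phi> T"
  proof (intro Bochner_Integration.integral_nonneg)
    fix h
    have "weights h k \<le> sum (weights h) {..<K}"
      using k weights_pos by (intro member_le_sum) (auto simp: less_imp_le)
    then show "0 \<le> potential k (weights h)"
      using weights_pos[of h k] by (simp add: potential_def)
  qed
  ultimately have "\<eta> * (\<Sum>t<T. G t - l t k) \<le> ln K + T * (\<eta>\<^sup>2 * V + \<eta> * \<gamma>)" by linarith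
  also have "\<dots> = \<eta> * (ln K / \<eta> + \<eta> * V * T + \<gamma> * T)"
    using eta_pos by (simp add: field_simps power2_eq_square)
  finally have "(\<Sum>t<T. G t - l t k) \<le> ln K / \<eta> + \<eta> * V * T + \<gamma> * T"
    using eta_pos by simp
  then show ?thesis
    by (simp add: expected_regret_def expected_cumulative_loss[OF valid_strat] k(2) G_def sum_subtractf)
qed

end

section \<open>Second moments of the estimates in terms of the graph\<close>

lemma finite_independent_cards: "finite (card ` {S. S \<subseteq> {..<K} \<and> independent_set E S})"
  by (rule finite_imageI, rule finite_subset[of _ "Pow {..<K}"]) auto

lemma card_le_independence_number:
  "S \<subseteq> {..<K} \<Longrightarrow> independent_set E S \<Longrightarrow> card S \<le> independence_number K E"
  unfolding independence_number_def by (intro Max_ge finite_independent_cards) auto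

lemma obtain_maximum_independent_set:
  obtains S where "S \<subseteq> {..<K}" "independent_set E S" "card S = independence_number K E"
proof -
  have "{} \<in> {S. S \<subseteq> {..<K} \<and> independent_set E S}" by (simp add: independent_set_def)
  then have "card ` {S. S \<subseteq> {..<K} \<and> independent_set E S} \<noteq> {}" by blast
  then have "independence_number K E \<in> card ` {S. S \<subseteq> {..<K} \<and> independent_set E S}"
    unfolding independence_number_def by (intro Max_in finite_independent_cards)
  then show thesis using that by force
qed

lemma independence_number_bounds:
  assumes "0 < K"
  shows "1 \<le> independence_number K E" "independence_number K E \<le> K"
proof -
  show "1 \<le> independence_number K E"
    using card_le_independence_number[of "{0}" K E] assms by (simp add: independent_set_def)
  obtain S where S: "S \<subseteq> {..<K}" "card S = independence_number K E"
    by (rule obtain_maximum_independent_set)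
  show "independence_number K E \<le> K" using card_mono[OF _ S(1)] S(2) by simp
qed

context exp3
begin

context
  fixes w x :: "nat \<Rightarrow> real"
  assumes w: "\<And>i. 0 < w i" and x: "\<And>i. 0 \<le> x i \<and> x i \<le> 1" and half: "\<gamma> \<le> 1/2"
begin

lemma q_le_twice_p: "q w i \<le> 2 * p w i"
proof -
  have "1/2 * q w i \<le> (1 - \<gamma>) * q w i"
    using half q_pos[of w, OF w, of i] by (intro mult_right_mono) auto
  then show ?thesis using p_ge(1)[of w, OF w, of i] by linarith
qed

lemma weighted_second_moment_le:
  assumes "j < K"
  shows "(\<Sum>i<K. p w i * (q w j * (estimate w (observe E x i) j)\<^sup>2)) \<le> q w j / P w j"
proof -
  have "(\<Sum>i<K. p w i * (q w j * (estimate w (observe E x i) j)\<^sup>2)) =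
      q w j * (\<Sum>i<K. p w i * (estimate w (observe E x i) j)\<^sup>2)"
    by (simp add: sum_distrib_left mult_ac)
  also have "\<dots> = q w j * ((x j)\<^sup>2 / P w j)"
    using estimate_second_moment[of w, OF w assms] by simp
  also have "\<dots> \<le> q w j * (1 / P w j)"
    using q_pos[of w, OF w, of j] P_pos[of w, OF w assms] x[of j]
    by (intro mult_left_mono divide_right_mono) (auto simp: power_le_one)
  finally show ?thesis by simp
qed

text \<open>A loop gives \<open>q w j \<le> 2 * P w j\<close>, so each such action adds at most 2.
  Every other action is seen from \<open>U\<close> with probability at least
  \<open>\<gamma> / card U\<close>, and the weights \<open>q\<close> sum to 1.\<close>

lemma variance_bound_dominating:
  assumes "0 < \<gamma>" and U: "U \<subseteq> {..<K}" "U \<noteq> {}" and u: "\<And>i. i \<in> U \<Longrightarrow> u i = 1 / card U"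
    and dom: "\<And>j. j < K \<Longrightarrow> (j, j) \<notin> E \<Longrightarrow> \<exists>d\<in>U. (d, j) \<in> E"
  shows "(\<Sum>i<K. p w i * (\<Sum>j<K. q w j * (estimate w (observe E x i) j - 0)\<^sup>2)) \<le> 2 * K + card U / \<gamma>"
proof -
  have cardU: "0 < card U" using U by (meson card_gt_0_iff finite_lessThan finite_subset)
  have "(\<Sum>i<K. p w i * (\<Sum>j<K. q w j * (estimate w (observe E x i) j - 0)\<^sup>2)) =
      (\<Sum>j<K. \<Sum>i<K. p w i * (q w j * (estimate w (observe E x i) j)\<^sup>2))"
    by (subst sum.swap) (simp add: sum_distrib_left)
  also have "\<dots> \<le> (\<Sum>j<K. q w j / P w j)"
    by (intro sum_mono weighted_second_moment_le) auto
  also have "\<dots> \<le> (\<Sum>j<K. 2 + q w j * (card U / \<gamma>))"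
  proof (intro sum_mono)
    fix j assume "j \<in> {..<K}"
    then have j: "j < K" by simp
    note pos = q_pos[of w, OF w, of j] P_pos[of w, OF w j]
    show "q w j / P w j \<le> 2 + q w j * (card U / \<gamma>)"
    proof (cases "(j, j) \<in> E")
      case True
      then have "q w j \<le> 2 * P w j" using q_le_twice_p[of j] p_le_P[of w, OF w j True] by simp
      then have "q w j / P w j \<le> 2" using pos by (simp add: field_simps)
      moreover have "0 \<le> q w j * (card U / \<gamma>)" using pos assms(1) by simp
      ultimately show ?thesis by linarith
    next
      case False
      then obtain d where d: "d \<in> U" "(d, j) \<in> E" using dom j by auto
      then have "\<gamma> / card U \<le> P w j"
        using p_ge(2)[of w, OF w, of d] p_le_P[of w, OF w, of d j] U(1) u[of d] by auto
      then have "q w j / P w j \<le> q w j / (\<gamma> / card U)"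
        using pos assms(1) cardU by (intro divide_left_mono mult_pos_pos) auto
      then show ?thesis by simp
    qed
  qed
  also have "\<dots> = 2 * K + card U / \<gamma>"
    unfolding sum.distrib sum_distrib_right[symmetric] q_sum[of w, OF w] by simp
  finally show ?thesis .
qed

lemma P_ge_without_loop:
  assumes "strongly_observable_graph K E" "j < K" "(j, j) \<notin> E"
  shows "1 - p w j \<le> P w j"
proof -
  have "{..<K} - {j} \<subseteq> {i\<in>{..<K}. (i, j) \<in> E}"
    using assms by (auto simp: strongly_observable_graph_def strongly_observable_vertex_def in_nbrs_def)
  then have "sum (p w) ({..<K} - {j}) \<le> P w j"
    unfolding P_def using p_pos[of w, OF w] by (intro sum_mono2) (auto simp: less_imp_le)
  moreover have "sum (p w) ({..<K} - {j}) = 1 - p w j"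
    using p_sum[of w, OF w] assms(2) by (simp add: sum_diff1)
  ultimately show ?thesis by simp
qed

text \<open>On actions with loops the closed in-weight of \<open>sum_weight_ratio_le\<close> is at
  most \<open>P\<close>, and uniform exploration keeps the weights above
  \<open>\<gamma> / K\<close>: this is the logarithmic term. An action without loop is seen by all
  others, so \<open>P w j \<ge> 1 - p w j \<ge> 1/2\<close> on \<open>A\<close>, and these actions
  add at most 2.\<close>

lemma sum_q_div_P_le:
  assumes "strongly_observable_graph K E" "0 < \<gamma>" and u: "\<And>i. i < K \<Longrightarrow> u i = 1 / K"
    and A: "A \<subseteq> {..<K}" "\<And>j. j \<in> A \<Longrightarrow> (j, j) \<notin> E \<Longrightarrow> p w j \<le> 1/2"
  shows "(\<Sum>j\<in>A. q w j / P w j) \<le> 4 * real (independence_number K E) * (1 + ln (K / \<gamma>)) + 2"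
proof -
  have finA: "finite A" using A(1) by (rule finite_subset) simp
  define S where "S = {j\<in>{..<K}. (j, j) \<in> E}"
  have P0: "0 \<le> q w j / P w j" if "j < K" for j
    using q_pos[of w, OF w, of j] P_pos[of w, OF w that] by simp
  have lnK: "0 \<le> ln (K / \<gamma>)" using K_pos assms(2) half by (intro ln_ge_zero) (simp add: field_simps)
  have loop: "(\<Sum>j\<in>S. q w j / P w j) \<le> 4 * real (independence_number K E) * (1 + ln (K / \<gamma>))"
  proof (cases "S = {}")
    case True
    then show ?thesis using lnK by simp
  next
    case False
    have "(\<Sum>j\<in>S. q w j / P w j) \<le> (\<Sum>j\<in>S. 2 * (p w j / sum (p w) {i\<in>S. (i, j) \<in> E \<or> i = j}))"
    proof (intro sum_mono)
      fix j assume j: "j \<in> S"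
      define Q where "Q = sum (p w) {i\<in>S. (i, j) \<in> E \<or> i = j}"
      have "Q \<le> P w j" unfolding P_def Q_def using p_pos[of w, OF w] j
        by (intro sum_mono2) (auto simp: S_def less_imp_le)
      moreover have "0 < Q" unfolding Q_def using p_pos[of w, OF w] j
        by (intro sum_pos) (auto simp: S_def)
      ultimately have "q w j / P w j \<le> 2 * p w j / Q"
        using q_le_twice_p[of j] q_pos[of w, OF w, of j] p_pos[of w, OF w, of j] by (intro frac_le) auto
      then show "q w j / P w j \<le> 2 * (p w j / Q)" by simp
    qed
    also have "\<dots> = 2 * (\<Sum>j\<in>S. p w j / sum (p w) {i\<in>S. (i, j) \<in> E \<or> i = j})"
      by (simp add: sum_distrib_left)
    also have "\<dots> \<le> 2 * (2 * real (independence_number K E) * (1 + ln (sum (p w) S / (\<gamma> / K))))"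
    proof (intro mult_left_mono sum_weight_ratio_le)
      show "\<gamma> / K \<le> p w v" if "v \<in> S" for v
        using p_ge(2)[of w, OF w, of v] u[of v] that by (simp add: S_def)
      show "card X \<le> independence_number K E" if "X \<subseteq> S" "independent_set E X" for X
        using that by (intro card_le_independence_number) (auto simp: S_def)
    qed (use False assms(2) K_pos in \<open>auto simp: S_def\<close>)
    also have "\<dots> \<le> 4 * real (independence_number K E) * (1 + ln (K / \<gamma>))"
    proof -
      have "0 < sum (p w) S" using False p_pos[of w, OF w] by (intro sum_pos) (auto simp: S_def)
      moreover have "sum (p w) S \<le> 1" unfolding p_sum[of w, OF w, symmetric] using p_pos[of w, OF w]
        by (intro sum_mono2) (auto simp: S_def less_imp_le)
      ultimately have "ln (sum (p w) S / (\<gamma> / K)) \<le> ln (K / \<gamma>)"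
        using assms(2) K_pos by (subst ln_le_cancel_iff) (auto simp: field_simps)
      then show ?thesis by (simp add: mult_left_mono)
    qed
    finally show ?thesis .
  qed
  have "(\<Sum>j\<in>A. q w j / P w j) = (\<Sum>j\<in>A \<inter> S. q w j / P w j) + (\<Sum>j\<in>A - S. q w j / P w j)"
    using finA by (subst sum.union_disjoint[symmetric]) (auto intro: sum.cong)
  also have "(\<Sum>j\<in>A \<inter> S. q w j / P w j) \<le> (\<Sum>j\<in>S. q w j / P w j)"
    using P0 by (intro sum_mono2) (auto simp: S_def)
  also note loop
  also have "(\<Sum>j\<in>A - S. q w j / P w j) \<le> (\<Sum>j\<in>A - S. 2 * q w j)"
  proof (intro sum_mono)
    fix j assume j: "j \<in> A - S"
    then have "1/2 \<le> P w j"
      using P_ge_without_loop[OF assms(1), of j] A by (force simp: S_def)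
    then have "q w j * 1 \<le> q w j * (2 * P w j)"
      using q_pos[of w, OF w, of j] by (intro mult_left_mono) auto
    then show "q w j / P w j \<le> 2 * q w j" using \<open>1/2 \<le> P w j\<close> by (simp add: field_simps)
  qed
  also have "\<dots> \<le> 2"
  proof -
    have "sum (q w) (A - S) \<le> sum (q w) {..<K}"
      using A(1) q_pos[of w, OF w] by (intro sum_mono2) (auto simp: less_imp_le)
    then show ?thesis using q_sum[of w, OF w] by (simp flip: sum_distrib_left)
  qed
  finally show ?thesis by simp
qed

text \<open>If an action without self-loop carries more than half of the mass, its estimate alone has an
  unbounded second moment. Exponential weights are invariant under shifts of the losses, and
  subtracting that estimate leaves the factor \<open>1 - q\<close> which compensates \<open>P \<ge> 1 - p\<close>.\<close>

lemma variance_bound_strongly_observable: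
  assumes strong: "strongly_observable_graph K E" and \<gamma>: "0 < \<gamma>" and \<eta>: "2 * \<eta> \<le> \<gamma>" and K2: "2 \<le> K"
    and u: "\<And>i. i < K \<Longrightarrow> u i = 1 / K"
  shows "\<exists>b. (\<forall>i<K. \<forall>j<K. - 1 \<le> \<eta> * (estimate w (observe E x i) j - b i)) \<and>
    (\<Sum>i<K. p w i * (\<Sum>j<K. q w j * (estimate w (observe E x i) j - b i)\<^sup>2)) \<le>
      8 * real (independence_number K E) * (1 + ln (K / \<gamma>)) + 8"
proof -
  let ?X = "\<lambda>i. estimate w (observe E x i)"
  let ?B = "4 * real (independence_number K E) * (1 + ln (K / \<gamma>))"
  have B: "0 \<le> ?B" using K_pos \<gamma> half by (intro mult_nonneg_nonneg add_nonneg_nonneg ln_ge_zero) (auto simp: field_simps)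
  have X0: "0 \<le> ?X i j" if "j < K" for i j
    using P_pos[of w, OF w that] x by (simp add: estimate_observe)
  show ?thesis
  proof (cases "\<exists>m<K. (m, m) \<notin> E \<and> 1/2 < p w m")
    case False
    have light: "p w j \<le> 1/2" if "j < K" "(j, j) \<notin> E" for j
      using False that by force
    have "(\<Sum>i<K. p w i * (\<Sum>j<K. q w j * (?X i j - 0)\<^sup>2)) =
      (\<Sum>j<K. \<Sum>i<K. p w i * (q w j * (?X i j)\<^sup>2))"
      by (subst sum.swap) (simp add: sum_distrib_left)
    also have "\<dots> \<le> (\<Sum>j<K. q w j / P w j)"
      by (intro sum_mono weighted_second_moment_le) auto
    also have "\<dots> \<le> ?B + 2"
      using light by (intro sum_q_div_P_le strong \<gamma> u) auto
    finally have "(\<Sum>i<K. p w i * (\<Sum>j<K. q w j * (?X i j - 0)\<^sup>2)) \<le> 8 * real (independence_number K E) * (1 + ln (K / \<gamma>)) + 8"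
      using B by simp
    moreover have "- 1 \<le> \<eta> * (?X i j - 0)" if "j < K" for i j
      using X0[OF that, of i] eta_pos by (simp add: order_trans[of "- 1" 0])
    ultimately show ?thesis by (intro exI[of _ "\<lambda>_. 0"]) auto
  next
    case True
    then obtain m where m: "m < K" "(m, m) \<notin> E" "1/2 < p w m" by auto
    have Pm: "1 - p w m \<le> P w m" using P_ge_without_loop[OF strong m(1,2)] .
    \<comment> \<open>\<open>1 - p w m\<close> has two parts: \<open>r\<close>, at least half of
      \<open>1 - q w m\<close>, cancels that factor in the second moment; \<open>r'\<close>, at
      least \<open>\<gamma> / 2\<close> since \<open>2 \<le> K\<close>, caps the subtracted estimate
      at \<open>2 / \<gamma> \<le> 1 / \<eta>\<close>.\<close>
    define r where "r = (1 - \<gamma>) * (1 - q w m)"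
    define r' where "r' = \<gamma> * (1 - 1 / K)"
    have pm: "1 - p w m = r + r'"
      using u[OF m(1)] by (simp add: p_def r_def r'_def algebra_simps)
    have qm: "q w m \<le> 1" unfolding q_sum[of w, OF w, symmetric] using m(1) q_pos[of w, OF w]
      by (intro member_le_sum) (auto simp: less_imp_le)
    have "1/2 \<le> 1 - 1 / real K" using K2 by (simp add: field_simps)
    then have r': "\<gamma> * (1/2) \<le> r'" unfolding r'_def using \<gamma> by (intro mult_left_mono) auto
    have r: "(1/2) * (1 - q w m) \<le> r" unfolding r_def
      using half qm by (intro mult_right_mono) auto
    have Pm_ge: "\<gamma> / 2 \<le> P w m" "(1 - q w m) / 2 \<le> P w m"
      using Pm pm \<gamma> qm r r' by simp_all
    have Pm_pos: "0 < P w m" using Pm_ge \<gamma> by simp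
    have bound: "- 1 \<le> \<eta> * (?X i j - ?X i m)" if "j < K" for i j
    proof -
      have "?X i m \<le> 1 / P w m"
        using x[of m] Pm_pos by (auto simp: estimate_observe divide_right_mono)
      also have "\<dots> \<le> 1 / (\<gamma> / 2)" using Pm_ge(1) \<gamma> by (intro divide_left_mono) auto
      finally have "\<eta> * ?X i m \<le> \<eta> * (2 / \<gamma>)" using eta_pos by (intro mult_left_mono) auto
      also have "\<dots> \<le> 1" using \<eta> \<gamma> by (simp add: field_simps)
      finally have "\<eta> * ?X i m \<le> 1" .
      moreover have "0 \<le> \<eta> * ?X i j" using X0[OF that, of i] eta_pos by simp
      ultimately show ?thesis unfolding right_diff_distrib by linarith
    qed
    \<comment> \<open>The shift annihilates the term of \<open>m\<close>; the other terms pay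
      \<open>2 * (?X i m)\<^sup>2\<close> with total weight \<open>1 - q w m\<close>.\<close>
    have split: "(\<Sum>j<K. q w j * (?X i j - ?X i m)\<^sup>2) \<le>
        2 * (\<Sum>j\<in>{..<K} - {m}. q w j * (?X i j)\<^sup>2) + 2 * (1 - q w m) * (?X i m)\<^sup>2" for i
    proof -
      have "(\<Sum>j<K. q w j * (?X i j - ?X i m)\<^sup>2) = (\<Sum>j\<in>{..<K} - {m}. q w j * (?X i j - ?X i m)\<^sup>2)"
        using m(1) by (simp add: sum.remove[of _ m])
      also have "\<dots> \<le> (\<Sum>j\<in>{..<K} - {m}. q w j * (2 * (?X i j)\<^sup>2 + 2 * (?X i m)\<^sup>2))"
      proof (intro sum_mono mult_left_mono)
        fix j
        have "0 \<le> (?X i j + ?X i m)\<^sup>2" by simp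
        then show "(?X i j - ?X i m)\<^sup>2 \<le> 2 * (?X i j)\<^sup>2 + 2 * (?X i m)\<^sup>2"
          by (simp add: power2_eq_square algebra_simps)
      qed (use q_pos[of w, OF w] in \<open>simp add: less_imp_le\<close>)
      also have "\<dots> = 2 * (\<Sum>j\<in>{..<K} - {m}. q w j * (?X i j)\<^sup>2) + 2 * sum (q w) ({..<K} - {m}) * (?X i m)\<^sup>2"
        by (simp add: distrib_left sum.distrib sum_distrib_left sum_distrib_right mult_ac)
      also have "sum (q w) ({..<K} - {m}) = 1 - q w m"
        using q_sum[of w, OF w] m(1) by (simp add: sum_diff1)
      finally show ?thesis .
    qed
    have "(\<Sum>i<K. p w i * (\<Sum>j<K. q w j * (?X i j - ?X i m)\<^sup>2)) \<le>
      (\<Sum>i<K. p w i * (2 * (\<Sum>j\<in>{..<K} - {m}. q w j * (?X i j)\<^sup>2) + 2 * (1 - q w m) * (?X i m)\<^sup>2))"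
      using p_pos[of w, OF w] split by (intro sum_mono mult_left_mono) (auto simp: less_imp_le)
    also have "\<dots> = 2 * (\<Sum>j\<in>{..<K} - {m}. \<Sum>i<K. p w i * (q w j * (?X i j)\<^sup>2)) +
        2 * (1 - q w m) * (\<Sum>i<K. p w i * (?X i m)\<^sup>2)"
      by (subst sum.swap) (simp add: distrib_left sum.distrib sum_distrib_left mult_ac)
    also have "(\<Sum>i<K. p w i * (?X i m)\<^sup>2) = (x m)\<^sup>2 / P w m"
      by (rule estimate_second_moment[of w, OF w m(1)])
    also have "2 * (\<Sum>j\<in>{..<K} - {m}. \<Sum>i<K. p w i * (q w j * (?X i j)\<^sup>2)) \<le> 2 * (?B + 2)"
    proof (intro mult_left_mono order.trans[OF sum_mono sum_q_div_P_le])
      fix j assume "j \<in> {..<K} - {m}"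
      then show "(\<Sum>i<K. p w i * (q w j * (?X i j)\<^sup>2)) \<le> q w j / P w j"
        by (intro weighted_second_moment_le) auto
      \<comment> \<open>Only one action can carry more than half of the mass, so
        \<open>sum_q_div_P_le\<close> applies to all actions but \<open>m\<close>.\<close>
      have "p w j + p w m = sum (p w) {j, m}"
        using \<open>j \<in> {..<K} - {m}\<close> by auto
      also have "\<dots> \<le> 1" unfolding p_sum[of w, OF w, symmetric]
        using p_pos[of w, OF w] m(1) \<open>j \<in> {..<K} - {m}\<close> by (intro sum_mono2) (auto simp: less_imp_le)
      finally show "p w j \<le> 1/2" using m(3) by simp
    qed (use strong \<gamma> u in auto)
    also have "2 * (1 - q w m) * ((x m)\<^sup>2 / P w m) \<le> 4"
    proof -
      have "2 * (1 - q w m) * ((x m)\<^sup>2 / P w m) \<le> 2 * (1 - q w m) * (1 / P w m)"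
        using qm Pm_pos x[of m] by (intro mult_left_mono divide_right_mono) (auto simp: power_le_one)
      also have "\<dots> \<le> 4" using Pm_ge(2) Pm_pos by (simp add: field_simps)
      finally show ?thesis .
    qed
    finally have "(\<Sum>i<K. p w i * (\<Sum>j<K. q w j * (?X i j - ?X i m)\<^sup>2)) \<le>
        8 * real (independence_number K E) * (1 + ln (K / \<gamma>)) + 8" by simp
    with bound show ?thesis by (intro exI[of _ "\<lambda>i. ?X i m"]) auto
  qed
qed

end

end

section \<open>Minimax regret\<close>

text \<open>Real-valued \<open>INF\<close> and \<open>SUP\<close> are informative only on bounded
  nonempty sets; these crude bounds supply the boundedness.\<close>

lemma expected_regret_bounds:
  assumes s: "valid_strategy K s" and l: "valid_losses l" and K: "0 < K"
  shows "- real T \<le> expected_regret K E s l T" "expected_regret K E s l T \<le> T"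
proof -
  note fin = finite_history_dist[OF s, of E l T]
  have "0 \<le> (\<Sum>t<T. l t (f t)) \<and> (\<Sum>t<T. l t (f t)) \<le> T" for f
    using l sum_nonneg[of "{..<T}" "\<lambda>t. l t (f t)"] sum_bounded_above[of "{..<T}" "\<lambda>t. l t (f t)" 1]
    by (auto simp: valid_losses_def)
  note bnd = this
  have "measure_pmf.expectation (history_dist E s l T) (\<lambda>_. 0) \<le>
      measure_pmf.expectation (history_dist E s l T) (\<lambda>h. \<Sum>t<T. l t (fst (h ! t)))"
    using bnd by (intro expectation_mono fin) auto
  moreover have "measure_pmf.expectation (history_dist E s l T) (\<lambda>h. \<Sum>t<T. l t (fst (h ! t))) \<le>
      measure_pmf.expectation (history_dist E s l T) (\<lambda>_. real T)"
    using bnd by (intro expectation_mono fin) auto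
  moreover have "Min ((\<lambda>i. \<Sum>t<T. l t i) ` {..<K}) \<in> (\<lambda>i. \<Sum>t<T. l t i) ` {..<K}"
    using K by (intro Min_in) auto
  then have "0 \<le> Min ((\<lambda>i. \<Sum>t<T. l t i) ` {..<K}) \<and> Min ((\<lambda>i. \<Sum>t<T. l t i) ` {..<K}) \<le> T"
    using bnd by auto
  ultimately show "- real T \<le> expected_regret K E s l T" "expected_regret K E s l T \<le> T"
    by (auto simp: expected_regret_def)
qed

lemma exists_valid_losses: "\<exists>l. valid_losses l"
  by (rule exI[of _ "\<lambda>_ _. 0"]) (simp add: valid_losses_def)

lemma bdd_above_regret:
  assumes "valid_strategy K s" "0 < K"
  shows "bdd_above ((\<lambda>l. expected_regret K E s l T) ` {l. valid_losses l})"
  using expected_regret_bounds(2)[OF assms(1) _ assms(2)] by (intro bdd_aboveI[of _ "real T"]) auto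

lemma minimax_regret_le:
  assumes K: "0 < K" and s: "valid_strategy K s"
    and B: "\<And>l. valid_losses l \<Longrightarrow> expected_regret K E s l T \<le> B"
  shows "minimax_regret K E T \<le> B"
proof -
  obtain l0 where l0: "valid_losses l0" using exists_valid_losses by auto
  have "minimax_regret K E T \<le> (SUP l\<in>{l. valid_losses l}. expected_regret K E s l T)"
    unfolding minimax_regret_def
  proof (intro cINF_lower bdd_belowI)
    fix r assume "r \<in> (\<lambda>s. SUP l\<in>{l. valid_losses l}. expected_regret K E s l T) ` {s. valid_strategy K s}"
    then obtain s' where s': "valid_strategy K s'"
      "r = (SUP l\<in>{l. valid_losses l}. expected_regret K E s' l T)" by auto
    have "- real T \<le> expected_regret K E s' l0 T" using expected_regret_bounds(1)[OF s'(1) l0 K] .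
    also have "\<dots> \<le> r" unfolding s'(2) using l0 by (intro cSUP_upper bdd_above_regret s' K) auto
    finally show "- real T \<le> r" .
  qed (use s in auto)
  also have "\<dots> \<le> B" using l0 B by (intro cSUP_least) auto
  finally show ?thesis .
qed

text \<open>Stated with an arbitrary regret bound \<open>R\<close> because the lower-bound arguments
  use \<open>R\<close> as a budget for exploration.\<close>

lemma minimax_regret_ge:
  assumes K: "0 < K"
    and B: "\<And>s R. valid_strategy K s \<Longrightarrow> (\<And>l. valid_losses l \<Longrightarrow> expected_regret K E s l T \<le> R) \<Longrightarrow> B \<le> R"
  shows "B \<le> minimax_regret K E T"
  unfolding minimax_regret_def
proof (intro cINF_greatest)
  have "valid_strategy K (\<lambda>_. return_pmf 0)" using K by (simp add: valid_strategy_def)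
  then show "{s. valid_strategy K s} \<noteq> {}" by auto
next
  fix s assume "s \<in> {s. valid_strategy K s}"
  then have s: "valid_strategy K s" by simp
  show "B \<le> (SUP l\<in>{l. valid_losses l}. expected_regret K E s l T)"
  proof (rule B[OF s])
    fix l assume "valid_losses l"
    then show "expected_regret K E s l T \<le> (SUP l\<in>{l. valid_losses l}. expected_regret K E s l T)"
      using bdd_above_regret[OF s K] by (intro cSUP_upper) auto
  qed
qed

lemma minimax_regret_le_T: "0 < K \<Longrightarrow> minimax_regret K E T \<le> T"
  by (rule minimax_regret_le[of _ "\<lambda>_. return_pmf 0"])
    (auto simp: valid_strategy_def intro: expected_regret_bounds(2))

text \<open>An action \<open>m\<close> that nobody sees loses constantly 0 or constantly 1, all
  others 1/2. Both games yield the same histories, and the two losses of any action add up to 1: the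
  player loses \<open>T\<close> in total, the comparators \<open>m\<close> and \<open>k\<close> lose
  0 and \<open>T / 2\<close>.\<close>

lemma minimax_regret_not_observable:
  assumes K: "2 \<le> K" and E: "E \<subseteq> {..<K} \<times> {..<K}" and no: "\<not> observable_graph K E"
  shows "T / 4 \<le> minimax_regret K E T"
proof (rule minimax_regret_ge)
  show "0 < K" using K by simp
  obtain m where m: "m < K" "\<And>i. (i, m) \<notin> E"
    using no E by (auto simp: observable_graph_def observable_vertex_def in_nbrs_def)
  define l where "l c (t::nat) i = (if i = m then c else 1/2)" for c :: real and t and i :: nat
  define k where "k = (if m = 0 then 1 else 0 :: nat)"
  have k: "k < K" "k \<noteq> m" using K by (auto simp: k_def)
  fix s R
  assume s: "valid_strategy K s" and R: "\<And>l. valid_losses l \<Longrightarrow> expected_regret K E s l T \<le> R"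
  note finH = finite_history_dist[OF s] and finS = finite_set_valid_strategy[OF s]
  have obs: "observation E (l 1) t = observation E (l 0) t" for t
    using m(2) by (auto simp: observation_def l_def fun_eq_iff)
  have hist: "history_dist E s (l 1) t = history_dist E s (l 0) t" for t
    by (induction t) (simp_all add: obs)
  define G where "G c t = measure_pmf.expectation (history_dist E s (l 0) t)
    (\<lambda>h. measure_pmf.expectation (s h) (l c t))" for c t
  have "G 0 t + G 1 t = 1" for t
  proof -
    have "G 0 t + G 1 t = measure_pmf.expectation (history_dist E s (l 0) t)
        (\<lambda>h. measure_pmf.expectation (s h) (\<lambda>i. l 0 t i + l 1 t i))"
      using finH finS by (simp add: G_def expectation_add)
    also have "(\<lambda>i. l 0 t i + l 1 t i) = (\<lambda>_. 1)" by (auto simp: l_def)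
    finally show ?thesis by simp
  qed
  then have "sum (G 0) {..<T} + sum (G 1) {..<T} = T" by (simp flip: sum.distrib)
  then have "(\<Sum>t<T. G 0 t - l 0 t m) + (\<Sum>t<T. G 1 t - l 1 t k) = T / 2"
    using k by (simp add: l_def sum_subtractf)
  moreover have "(\<Sum>t<T. G 0 t - l 0 t m) \<le> R" unfolding G_def
    by (rule order.trans[OF expected_regret_ge[OF s m(1)] R]) (auto simp: valid_losses_def l_def)
  moreover have "(\<Sum>t<T. G 1 t - l 1 t k) \<le> R" unfolding G_def hist[symmetric]
    by (rule order.trans[OF expected_regret_ge[OF s k(1)] R]) (auto simp: valid_losses_def l_def)
  ultimately show "T / 4 \<le> R" by simp
qed

section \<open>Strongly observable graphs: the rate \<open>sqrt \<alpha> * sqrt T\<close>\<close>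

lemma minimax_regret_strongly_observable_le:
  assumes K: "2 \<le> K" "K ^ 3 \<le> T" and strong: "strongly_observable_graph K E"
  shows "minimax_regret K E T \<le>
    13 * sqrt (independence_number K E) * sqrt T * (1 + ln (real K * real T))"
proof -
  define a where "a = real (independence_number K E)"
  define X where "X = sqrt (a * T)"
  define L where "L = 1 + ln (real K * real T)"
  \<comment> \<open>Up to logarithms the second moment is of order \<open>a\<close>, so
    \<open>ln K / \<eta>\<close> and \<open>\<eta> * V * T\<close> balance at order
    \<open>X\<close>. The exploration \<open>2 * \<eta>\<close> is the least that the shifted
    estimates allow.\<close>
  define \<eta> where "\<eta> = 1 / (4 * X)"
  have "K \<le> K ^ 3" using K(1) by (intro self_le_power) auto
  then have KT: "K \<le> T" "1 \<le> T" using K by auto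
  have a: "1 \<le> a" "a \<le> K"
    using independence_number_bounds[of K E] K(1) by (auto simp: a_def)
  have aT: "1 \<le> a * T" using a KT mult_mono[of 1 a 1 "real T"] by simp
  have XX: "X * X = a * T" using aT by (simp add: X_def)
  have X1: "1 \<le> X" using aT by (simp add: X_def)
  have XK: "X \<le> K * T"
  proof -
    have "X * 1 \<le> X * X" using X1 by (intro mult_left_mono) auto
    also have "\<dots> \<le> K * T" unfolding XX using a by (simp add: mult_right_mono)
    finally show ?thesis by simp
  qed
  have KT1: "1 \<le> real K * real T" using K(1) KT mult_mono[of 1 "real K" 1 "real T"] by simp
  have lnKT: "0 \<le> ln (real K * real T)" using KT1 by simp
  interpret exp3 K E \<eta> "2 * \<eta>" "\<lambda>i. if i < K then 1 / real K else 0"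
  proof
    show "observable_graph K E"
      unfolding observable_graph_def observable_vertex_def
    proof (intro allI impI)
      fix i assume i: "i < K"
      define j where "j = (if i = 0 then 1 else 0 :: nat)"
      have "j < K" "j \<noteq> i" using K(1) by (auto simp: j_def)
      then show "in_nbrs E i \<inter> {..<K} \<noteq> {}"
        using strong i unfolding strongly_observable_graph_def strongly_observable_vertex_def by blast
    qed
  qed (use K X1 in \<open>auto simp: \<eta>_def field_simps\<close>)
  define V where "V = 8 * a * (1 + ln (K / (2 * \<eta>))) + 8"
  have lnX: "ln (K / (2 * \<eta>)) \<le> 2 * L"
  proof -
    have "ln (K / (2 * \<eta>)) = ln (2 * (K * X))" using X1 by (simp add: \<eta>_def mult_ac)
    also have "\<dots> \<le> ln (2 * ((K * T) * (K * T)))"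
    proof -
      have "1 * (K * X) \<le> real T * (K * (K * T))"
        using XK X1 K KT by (intro mult_mono) auto
      moreover have "0 < K * X" using K(1) X1 by simp
      ultimately show ?thesis by (subst ln_le_cancel_iff) (auto simp: mult_ac)
    qed
    also have "\<dots> = ln 2 + 2 * ln (real K * real T)" using K KT by (simp add: ln_mult_pos)
    also have "\<dots> \<le> 2 * L" using ln_2_less_1 by (simp add: L_def)
    finally show ?thesis .
  qed
  have "minimax_regret K E T \<le> ln K / \<eta> + \<eta> * V * T + 2 * \<eta> * T"
  proof (intro minimax_regret_le[OF _ valid_strat] expected_regret_le)
    fix w x :: "nat \<Rightarrow> real" assume wx: "\<And>i. 0 < w i" "\<And>i. 0 \<le> x i \<and> x i \<le> 1"
    show "\<exists>b. (\<forall>i<K. \<forall>j<K. - 1 \<le> \<eta> * (estimate w (observe E x i) j - b i)) \<and>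
        (\<Sum>i<K. p w i * (\<Sum>j<K. q w j * (estimate w (observe E x i) j - b i)\<^sup>2)) \<le> V"
      unfolding V_def a_def using K(1) eta_pos X1
      by (intro variance_bound_strongly_observable wx strong) (auto simp: \<eta>_def field_simps)
  qed (use K(1) in auto)
  also have "\<dots> \<le> 13 * X * L"
  proof -
    have "\<eta> * V * T \<le> \<eta> * (8 * a * (1 + 2 * L) + 8 * a) * T"
      unfolding V_def using lnX a eta_pos
      by (intro mult_right_mono mult_left_mono add_mono) auto
    also have "\<dots> = \<eta> * (X * X) * (16 + 16 * L)" unfolding XX by (simp add: algebra_simps)
    also have "\<dots> = X * (4 + 4 * L)" using X1 by (simp add: \<eta>_def field_simps)
    finally have 1: "\<eta> * V * T \<le> 4 * X + 4 * (X * L)" by (simp add: algebra_simps)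
    have "2 * \<eta> * T \<le> 2 * \<eta> * (X * X)"
      unfolding XX using a eta_pos KT by (intro mult_left_mono) (auto simp: mult_le_cancel_right1)
    also have "\<dots> = X / 2" using X1 by (simp add: \<eta>_def)
    finally have 2: "2 * \<eta> * T \<le> X / 2" .
    have "ln K / \<eta> = 4 * X * ln K" by (simp add: \<eta>_def)
    also have "\<dots> \<le> 4 * X * L"
    proof -
      have "ln (real K) \<le> ln (real K * real T)"
        using K(1) KT by (subst ln_le_cancel_iff) (auto simp: mult_le_cancel_left1)
      then show ?thesis using X1 by (simp add: L_def)
    qed
    finally have 3: "ln K / \<eta> \<le> 4 * (X * L)" by simp
    have "X * 1 \<le> X * L" using X1 lnKT by (intro mult_left_mono) (auto simp: L_def)
    then show ?thesis using 1 2 3 X1 by linarith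
  qed
  finally show ?thesis by (simp add: X_def a_def L_def real_sqrt_mult mult_ac)
qed

text \<open>Either \<open>m * R \<le> T\<close> and \<open>regret_lower_bound_many\<close> applies,
  or \<open>R > T / m\<close>, which is at least \<open>sqrt m * sqrt T\<close> because
  \<open>m ^ 3 \<le> K ^ 3 \<le> T\<close>.\<close>

lemma minimax_regret_strongly_observable_ge:
  assumes K: "2 \<le> K" "K ^ 3 \<le> T"
  shows "sqrt (independence_number K E) * sqrt T / 64 \<le> minimax_regret K E T"
proof (rule minimax_regret_ge)
  show "0 < K" using K by simp
  have "K \<le> K ^ 3" using K(1) by (intro self_le_power) auto
  then have KT: "K \<le> T" using K by auto
  obtain U where U: "U \<subseteq> {..<K}" "2 \<le> card U" "independence_number K E \<le> card U"
    and deg: "\<And>i. i \<in> U \<Longrightarrow> card {k\<in>U. (i, k) \<in> E} \<le> 2"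
  proof (cases "2 \<le> independence_number K E")
    case True
    obtain S where S: "S \<subseteq> {..<K}" "independent_set E S" "card S = independence_number K E"
      by (rule obtain_maximum_independent_set)
    have "card {k\<in>S. (i, k) \<in> E} \<le> 2" if "i \<in> S" for i
    proof -
      have "{k\<in>S. (i, k) \<in> E} \<subseteq> {i}" using S(2) that by (auto simp: independent_set_def)
      then have "card {k\<in>S. (i, k) \<in> E} \<le> card {i}" by (intro card_mono) auto
      then show ?thesis by simp
    qed
    then show ?thesis using S True by (intro that[of S]) auto
  next
    \<comment> \<open>Two coins are needed even for independence number 1; the actions 0 and 1
      serve, each seeing at most both.\<close>
    case False
    have "card {k\<in>{0, 1}. (i, k) \<in> E} \<le> 2" for i
    proof -
      have "card {k\<in>{0, 1}. (i, k) \<in> E} \<le> card {0, 1 :: nat}" by (intro card_mono) auto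
      also have "\<dots> = 2" by simp
      finally show ?thesis .
    qed
    then show ?thesis using K(1) False by (intro that[of "{0, 1}"]) auto
  qed
  define m where "m = real (card U)"
  have "card U \<le> card {..<K}" using U(1) by (intro card_mono) auto
  then have m: "2 \<le> m" "m \<le> K" using U(2) by (auto simp: m_def)
  define Y where "Y = sqrt (m / T)"
  have Tpos: "0 < real T" using K KT by simp
  have YY: "Y * Y = m / T" using m Tpos by (simp add: Y_def)
  have Y: "0 < Y" "Y \<le> 1" using m Tpos KT by (auto simp: Y_def)
  have YT: "Y * T = sqrt m * sqrt T"
  proof -
    have "Y * T = sqrt m * (T / sqrt T)" by (simp add: Y_def real_sqrt_divide)
    then show ?thesis using Tpos by (simp add: real_div_sqrt)
  qed
  have goal: "sqrt (independence_number K E) * sqrt T / 64 \<le> Y * T / 64"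
    unfolding YT using U(3) by (intro divide_right_mono mult_right_mono) (auto simp: m_def)
  fix s R
  assume s: "valid_strategy K s" and R: "\<And>l. valid_losses l \<Longrightarrow> expected_regret K E s l T \<le> R"
  show "sqrt (independence_number K E) * sqrt T / 64 \<le> R"
  proof (cases "2 * T + 2 * m * R \<le> 4 * T")
    case True
    \<comment> \<open>\<open>\<epsilon> = Y / 16\<close> makes the observation budget
      \<open>4 * T\<close>, of which plays inside \<open>U\<close> use at most
      \<open>2 * T\<close>.\<close>
    have "(Y / 16) * T / 4 \<le> R"
    proof (rule regret_lower_bound_many[OF s U(1,2) _ _ _ _ R])
      show "real (card {k\<in>U. (i, k) \<in> E}) \<le> 2" if "i \<in> U" for i
        using deg[OF that] by simp
      show "real (card {k\<in>U. (i, k) \<in> E}) \<le> m" for i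
        using card_mono[of U "{k\<in>U. (i, k) \<in> E}"] finite_subset[OF U(1)] by (simp add: m_def)
      have "card U / (64 * (Y / 16)\<^sup>2) = 4 * T"
        using YY m by (simp add: power_divide power2_eq_square m_def[symmetric])
      then show "2 * real T + 2 * m * R \<le> card U / (64 * (Y / 16)\<^sup>2)" using True by simp
    qed (use Y m in auto)
    then show ?thesis using goal by simp
  next
    case False
    have "real (card U) ^ 3 \<le> real K ^ 3" using m by (intro power_mono) (auto simp: m_def)
    also have "real K ^ 3 \<le> T" using K(2) by (metis of_nat_le_iff of_nat_power)
    finally have m3: "m ^ 3 \<le> T" by (simp add: m_def)
    have "(m * Y)\<^sup>2 = m * m * (Y * Y)" by (simp add: power2_eq_square)
    also have "\<dots> = m ^ 3 / T" unfolding YY by (simp add: power3_eq_cube)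
    also have "\<dots> \<le> 1\<^sup>2" using m3 Tpos by simp
    finally have "m * Y \<le> 1" by (rule power2_le_imp_le) simp
    then have "m * Y * T \<le> 1 * real T" by (intro mult_right_mono) auto
    also have "\<dots> \<le> m * R" using False by simp
    finally have "m * (Y * T) \<le> m * R" by (simp add: mult_ac)
    then have "Y * T \<le> R" using m by simp
    moreover have "0 \<le> Y * T" using Y Tpos by simp
    ultimately show ?thesis using goal by simp
  qed
qed

section \<open>Weakly observable graphs: the rate
  \<open>\<delta> powr (1/3) * T powr (2/3)\<close>\<close>

lemma powr_third_cube: "0 \<le> x \<Longrightarrow> (x powr (1/3)) ^ 3 = (x::real)"
  by (cases "x = 0") (auto simp: powr_powr simp flip: powr_numeral)

lemma powr_two_thirds: "0 \<le> x \<Longrightarrow> x powr (2/3) = (x powr (1/3))\<^sup>2" for x :: real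
  by (cases "x = 0") (auto simp: powr_powr simp flip: powr_numeral)

lemma weak_domination_number_bounds:
  assumes "weakly_observable_graph K E"
  shows "1 \<le> weak_domination_number K E" "weak_domination_number K E \<le> K"
proof -
  obtain D where D: "D \<subseteq> {..<K}" "card D = weak_domination_number K E"
    "\<forall>w\<in>weak_vertices K E. \<exists>d\<in>D. (d, w) \<in> E" by (rule obtain_weak_dominating_set)
  have "weak_vertices K E \<noteq> {}"
    using assms by (auto simp: weakly_observable_graph_def weak_vertices_def
        weakly_observable_vertex_def observable_graph_def strongly_observable_graph_def)
  then have "D \<noteq> {}" using D(3) by auto
  moreover have "finite D" using D(1) by (rule finite_subset) simp
  ultimately show "1 \<le> weak_domination_number K E" using D(2) by (simp add: Suc_le_eq card_gt_0_iff flip: D(2))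
  show "weak_domination_number K E \<le> K" using card_mono[OF _ D(1)] D(2) by simp
qed

lemma minimax_regret_weakly_observable_le:
  assumes K: "2 \<le> K" "K ^ 3 \<le> T" and weak: "weakly_observable_graph K E"
  shows "minimax_regret K E T \<le> 10 * weak_domination_number K E powr (1/3) * T powr (2/3) *
    (1 + ln (real K * real T))"
proof -
  define \<delta> where "\<delta> = real (weak_domination_number K E)"
  define A where "A = \<delta> powr (1/3)"
  define B where "B = real T powr (1/3)"
  define L where "L = 1 + ln (real K * real T)"
  \<comment> \<open>These values balance \<open>1 / \<eta>\<close>, \<open>\<gamma> * T\<close> and
    the exploration term \<open>\<eta> * (\<delta> / \<gamma>) * T\<close> at order
    \<open>A * B\<^sup>2\<close>.\<close>
  define \<eta> where "\<eta> = 1 / (A * B\<^sup>2)"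
  define \<gamma> where "\<gamma> = A / (2 * B)"
  obtain D where D: "D \<subseteq> {..<K}" "card D = weak_domination_number K E"
    "\<forall>w\<in>weak_vertices K E. \<exists>d\<in>D. (d, w) \<in> E" by (rule obtain_weak_dominating_set)
  \<comment> \<open>A strongly observable action without loop is seen by every other action, hence
    by 0 or by 1.\<close>
  define U where "U = D \<union> {0, 1}"
  have U: "U \<subseteq> {..<K}" "U \<noteq> {}" using D(1) K(1) by (auto simp: U_def)
  have finU: "finite U" using U(1) by (rule finite_subset) simp
  have cardU: "0 < card U" using finU U(2) by (simp add: card_gt_0_iff)
  have "card U \<le> card D + card {0, 1 :: nat}" unfolding U_def by (rule card_Un_le)
  then have n: "real (card U) \<le> 3 * \<delta>"
    using D(2) weak_domination_number_bounds[OF weak] by (simp add: \<delta>_def)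
  have \<delta>: "1 \<le> \<delta>" "\<delta> \<le> K" using weak_domination_number_bounds[OF weak] by (auto simp: \<delta>_def)
  have "K \<le> K ^ 3" using K(1) by (intro self_le_power) auto
  then have KT: "K \<le> T" "1 \<le> T" using K by auto
  have A3: "A ^ 3 = \<delta>" and B3: "B ^ 3 = T" using \<delta> by (simp_all add: A_def B_def powr_third_cube)
  have A1: "1 \<le> A" using \<delta> by (simp add: A_def ge_one_powr_ge_zero)
  have "real K ^ 3 \<le> B ^ 3" unfolding B3 using K(2) by (metis of_nat_le_iff of_nat_power)
  moreover have "0 \<le> B" by (simp add: B_def)
  ultimately have KB: "real K \<le> B" using power_mono_iff[of "real K" B 3] by simp
  have AB: "A \<le> B" unfolding A_def B_def using \<delta> KT by (intro powr_mono2) auto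
  have B2: "2 \<le> B" using KB K(1) by simp
  have KT1: "1 \<le> real K * real T" using K(1) KT mult_mono[of 1 "real K" 1 "real T"] by simp
  have lnKT: "0 \<le> ln (real K * real T)" using KT1 by simp
  have \<gamma>: "0 < \<gamma>" "\<gamma> \<le> 1/2" using A1 B2 AB by (auto simp: \<gamma>_def field_simps)
  have obs: "observable_graph K E" using weak by (simp add: weakly_observable_graph_def)
  interpret exp3 K E \<eta> \<gamma> "\<lambda>i. if i \<in> U then 1 / real (card U) else 0"
  proof
    have "sum (\<lambda>i. if i \<in> U then 1 / real (card U) else 0) {..<K} = sum (\<lambda>i. 1 / real (card U)) U"
      using U(1) by (intro sum.mono_neutral_cong_right) auto
    then show "sum (\<lambda>i. if i \<in> U then 1 / real (card U) else 0) {..<K} = 1" using cardU by simp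
  qed (use K A1 B2 \<gamma> obs in \<open>auto simp: \<eta>_def\<close>)
  have dom: "\<exists>d\<in>U. (d, j) \<in> E" if j: "j < K" "(j, j) \<notin> E" for j
  proof (cases "weakly_observable_vertex K E j")
    case True
    then show ?thesis using D(3) j by (auto simp: weak_vertices_def U_def)
  next
    case False
    then have "strongly_observable_vertex K E j"
      using obs j by (auto simp: weakly_observable_vertex_def observable_graph_def)
    then have sub: "{..<K} - {j} \<subseteq> in_nbrs E j"
      using j by (auto simp: strongly_observable_vertex_def in_nbrs_def)
    have "(if j = 0 then 1 else 0) \<in> {..<K} - {j}" using K(1) by auto
    then have "(if j = 0 then 1 else 0, j) \<in> E" using sub by (auto simp: in_nbrs_def)
    then show ?thesis by (auto simp: U_def split: if_splits)
  qed
  have "minimax_regret K E T \<le> ln K / \<eta> + \<eta> * (2 * K + card U / \<gamma>) * T + \<gamma> * T"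
  proof (intro minimax_regret_le[OF _ valid_strat] expected_regret_le)
    fix w x :: "nat \<Rightarrow> real" assume wx: "\<And>i. 0 < w i" "\<And>i. 0 \<le> x i \<and> x i \<le> 1"
    have "- 1 \<le> \<eta> * (estimate w (observe E x i) j - 0)" if "j < K" for i j
    proof -
      have "0 \<le> \<eta> * (estimate w (observe E x i) j - 0)"
        using eta_pos P_pos[of w, OF wx(1) that] wx(2)[of j] by (simp add: estimate_observe)
      then show ?thesis by linarith
    qed
    moreover have "(\<Sum>i<K. p w i * (\<Sum>j<K. q w j * (estimate w (observe E x i) j - 0)\<^sup>2)) \<le> 2 * K + card U / \<gamma>"
      by (intro variance_bound_dominating wx \<gamma> U dom) auto
    ultimately show "\<exists>b. (\<forall>i<K. \<forall>j<K. - 1 \<le> \<eta> * (estimate w (observe E x i) j - b i)) \<and>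
        (\<Sum>i<K. p w i * (\<Sum>j<K. q w j * (estimate w (observe E x i) j - b i)\<^sup>2)) \<le> 2 * K + card U / \<gamma>"
      by (intro exI[of _ "\<lambda>_. 0"]) auto
  qed (use K(1) in auto)
  also have "\<dots> \<le> 10 * (A * B\<^sup>2) * L"
  proof -
    have AB0: "0 < A" "0 < B" using A1 B2 by auto
    have B3': "real T = B * B\<^sup>2" using B3 by (simp add: power2_eq_square power3_eq_cube)
    have A3': "\<delta> = A * A\<^sup>2" using A3 by (simp add: power2_eq_square power3_eq_cube)
    have "\<eta> * (2 * K) * T = 2 * K * B / A"
      unfolding B3' \<eta>_def using AB0 by (simp add: field_simps)
    \<comment> \<open>\<open>K \<le> B\<close>, that is \<open>K ^ 3 \<le> T\<close>, absorbs the
      cost of the loops.\<close>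
    also have "\<dots> \<le> 2 * B * B / 1"
      using KB A1 AB0 by (intro frac_le mult_mono) auto
    also have "\<dots> \<le> 2 * (A * B\<^sup>2)" using A1 AB0 by (simp add: power2_eq_square)
    finally have 1: "\<eta> * (2 * K) * T \<le> 2 * (A * B\<^sup>2)" .
    have "\<eta> * (card U / \<gamma>) * T \<le> \<eta> * (3 * \<delta> / \<gamma>) * T"
      using n eta_pos \<gamma> by (intro mult_right_mono mult_left_mono divide_right_mono) auto
    also have "\<dots> = 6 * (A * B\<^sup>2)"
      unfolding B3' A3' \<eta>_def \<gamma>_def using AB0 by (simp add: field_simps power2_eq_square)
    finally have 2: "\<eta> * (card U / \<gamma>) * T \<le> 6 * (A * B\<^sup>2)" .
    have 3: "\<gamma> * T = (A * B\<^sup>2) / 2"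
      unfolding B3' \<gamma>_def using AB0 by (simp add: field_simps)
    have "ln (real K) \<le> ln (real K * real T)"
      using K(1) KT by (subst ln_le_cancel_iff) (auto simp: mult_le_cancel_left1)
    then have "(A * B\<^sup>2) * ln K \<le> (A * B\<^sup>2) * (L - 1)"
      using AB0 by (intro mult_left_mono) (auto simp: L_def)
    moreover have "ln K / \<eta> = (A * B\<^sup>2) * ln K" by (simp add: \<eta>_def)
    ultimately have 4: "ln K / \<eta> \<le> (A * B\<^sup>2) * L - A * B\<^sup>2" by (simp add: algebra_simps)
    have "(A * B\<^sup>2) * 1 \<le> (A * B\<^sup>2) * L" using AB0 lnKT by (intro mult_left_mono) (auto simp: L_def)
    moreover have "\<eta> * (2 * K + card U / \<gamma>) * T = \<eta> * (2 * K) * T + \<eta> * (card U / \<gamma>) * T"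
      by (simp add: algebra_simps)
    moreover have "0 < A * B\<^sup>2" using AB0 by simp
    ultimately show ?thesis using 1 2 3 4 by linarith
  qed
  finally show ?thesis by (simp add: A_def B_def \<delta>_def L_def powr_two_thirds mult_ac)
qed

text \<open>\<open>\<epsilon> = 1 / (4 * B)\<close> makes the observation budget
  \<open>B\<^sup>2 / 4\<close>: either \<open>2 * R\<close> exceeds it, or the two-action game
  yields order \<open>\<epsilon> * T\<close>, again \<open>B\<^sup>2\<close>.\<close>

lemma single_vertex_lower_bound:
  assumes weak: "weakly_observable_graph K E" and K: "2 \<le> K" "K \<le> T"
  shows "(real T powr (1/3))\<^sup>2 / 32 \<le> minimax_regret K E T"
proof (rule minimax_regret_ge)
  show "0 < K" using K by simp
  obtain w where w: "w < K" "\<not> strongly_observable_vertex K E w"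
    using weak by (auto simp: weakly_observable_graph_def strongly_observable_graph_def)
  then obtain j where j: "j < K" "j \<noteq> w" "(w, w) \<notin> E" "(j, w) \<notin> E"
    by (auto simp: strongly_observable_vertex_def in_nbrs_def)
  define B where "B = real T powr (1/3)"
  have B1: "1 \<le> B" using K by (simp add: B_def ge_one_powr_ge_zero)
  have B3: "real T = B * B\<^sup>2"
    using powr_third_cube[of "real T"] by (simp add: B_def power2_eq_square power3_eq_cube)
  fix s R
  assume s: "valid_strategy K s" and R: "\<And>l. valid_losses l \<Longrightarrow> expected_regret K E s l T \<le> R"
  have eq: "1 / (64 * (1 / (4 * B))\<^sup>2) = B\<^sup>2 / 4" using B1 by (simp add: field_simps)
  show "(real T powr (1/3))\<^sup>2 / 32 \<le> R"
  proof (cases "2 * R \<le> B\<^sup>2 / 4")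
    case True
    have "1 / (4 * B) * T * (3/16) \<le> R"
      using j w(1) B1 True eq
      by (intro regret_lower_bound_single[OF s w(1) j(1) _ j(3,4) _ _ R]) (auto simp: field_simps)
    moreover have "1 / (4 * B) * T * (3/16) = B\<^sup>2 * (3/64)" unfolding B3 using B1 by simp
    moreover have "0 \<le> B\<^sup>2" by simp
    ultimately show ?thesis unfolding B_def[symmetric] by linarith
  next
    case False
    moreover have "0 \<le> B\<^sup>2" by simp
    ultimately show ?thesis unfolding B_def[symmetric] by linarith
  qed
qed

text \<open>Weakly observable vertices have no loops and \<open>S\<close> is independent, so plays
  inside \<open>S\<close> reveal nothing about \<open>S\<close>, and a play outside reveals at most
  \<open>d\<close> coins. \<open>Y\<close> balances the budget, of order
  \<open>card S / Y\<^sup>2\<close>, with \<open>d\<close> times a regret of order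
  \<open>Y * T\<close>.\<close>

lemma independent_set_lower_bound:
  fixes d Y :: real
  assumes K: "2 \<le> K" "K \<le> T" and S: "S \<subseteq> weak_vertices K E" "independent_set E S" "2 \<le> card S"
    and d: "1 \<le> d" "\<And>v. v < K \<Longrightarrow> card {w\<in>S. (v, w) \<in> E} \<le> d"
    and Y: "Y ^ 3 = card S / (d * T)" "0 < Y"
  shows "Y * T / 16 \<le> minimax_regret K E T"
proof (rule minimax_regret_ge)
  show "0 < K" using K by simp
  have SK: "S \<subseteq> {..<K}" using S(1) by (auto simp: weak_vertices_def)
  define m where "m = real (card S)"
  have "card S \<le> card {..<K}" using SK by (intro card_mono) auto
  then have m: "2 \<le> m" "m \<le> T" using S(3) K by (auto simp: m_def)
  have Tpos: "0 < real T" using K by simp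
  have Y3: "Y * Y\<^sup>2 = m / (d * T)" using Y(1) by (simp add: m_def power2_eq_square power3_eq_cube)
  have "Y ^ 3 \<le> 1 ^ 3" unfolding Y(1) using m d(1) Tpos mult_mono[of 1 d m "real T"]
    by (simp add: m_def[symmetric])
  then have Y1: "Y \<le> 1" using power_mono_iff[of Y 1 3] Y(2) by simp
  fix s R
  assume s: "valid_strategy K s" and R: "\<And>l. valid_losses l \<Longrightarrow> expected_regret K E s l T \<le> R"
  have eq: "card S / (64 * (Y / 4)\<^sup>2) = m / (4 * Y\<^sup>2)" by (simp add: m_def power_divide)
  have mY: "m / (4 * Y\<^sup>2) = d * (Y * T) / 4"
    using Y3 Y(2) d(1) Tpos by (simp add: field_simps)
  have YT: "0 < Y * T" using Y(2) Tpos by simp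
  show "Y * T / 16 \<le> R"
  proof (cases "2 * d * R \<le> m / (4 * Y\<^sup>2)")
    case True
    have "(Y / 4) * T / 4 \<le> R"
    proof (rule regret_lower_bound_many[OF s SK S(3) _ _ _ _ R])
      show "real (card {k\<in>S. (i, k) \<in> E}) \<le> 0" if "i \<in> S" for i
      proof -
        have "\<not> strongly_observable_vertex K E i"
          using S(1) that by (auto simp: weak_vertices_def weakly_observable_vertex_def)
        then have "(i, i) \<notin> E" by (auto simp: strongly_observable_vertex_def in_nbrs_def)
        then have none: "{k\<in>S. (i, k) \<in> E} = {}" using S(2) that by (auto simp: independent_set_def)
        show ?thesis unfolding none by simp
      qed
      show "real (card {k\<in>S. (i, k) \<in> E}) \<le> d" if "i < K" for i using d(2)[OF that] .
      show "0 * real T + 2 * d * R \<le> card S / (64 * (Y / 4)\<^sup>2)" using True eq by simp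
    qed (use Y(2) Y1 d(1) in auto)
    then show ?thesis by simp
  next
    case False
    then have "d * (Y * T / 8) < d * R" unfolding mY by simp
    then have "Y * T / 8 < R" using d(1) by simp
    then show ?thesis using YT by simp
  qed
qed

text \<open>Passing from \<delta> to \<open>card S\<close> loses \<open>\<Lambda>\<^sup>2\<close>,
  and the degree bound loses another \<Lambda>; the cube root turns \<open>\<Lambda> ^ 3\<close>
  into a single logarithm.\<close>

lemma minimax_regret_weakly_observable_ge:
  assumes K: "2 \<le> K" "K ^ 3 \<le> T" and weak: "weakly_observable_graph K E"
  shows "weak_domination_number K E powr (1/3) * T powr (2/3) / (128 * (1 + ln (real K * real T)))
    \<le> minimax_regret K E T"
proof -
  define n where "n = weak_domination_number K E"
  define \<delta> where "\<delta> = real n"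
  define A where "A = \<delta> powr (1/3)"
  define B where "B = real T powr (1/3)"
  define \<Lambda> where "\<Lambda> = 1 + ln (real K * real T)"
  have \<delta>: "1 \<le> \<delta>" using weak_domination_number_bounds[OF weak] by (auto simp: \<delta>_def n_def)
  have "K \<le> K ^ 3" using K(1) by (intro self_le_power) auto
  then have KT: "K \<le> T" "1 \<le> T" using K by auto
  have A3: "A ^ 3 = \<delta>" and B3: "B ^ 3 = T" using \<delta> by (simp_all add: A_def B_def powr_third_cube)
  have A1: "1 \<le> A" "1 \<le> B" using \<delta> KT by (simp_all add: A_def B_def ge_one_powr_ge_zero)
  have KT1: "1 \<le> real K * real T" using K(1) KT mult_mono[of 1 "real K" 1 "real T"] by simp
  have \<Lambda>1: "1 \<le> \<Lambda>" using KT1 by (simp add: \<Lambda>_def)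
  have ln\<Lambda>: "ln K < \<Lambda>"
  proof -
    have "ln (real K) \<le> ln (real K * real T)"
      using K(1) KT by (subst ln_le_cancel_iff) (auto simp: mult_le_cancel_left1)
    then show ?thesis by (simp add: \<Lambda>_def)
  qed
  have "A * B\<^sup>2 / (128 * \<Lambda>) \<le> minimax_regret K E T"
  proof (cases "\<delta> \<le> 64 * \<Lambda>\<^sup>2")
    \<comment> \<open>Below this threshold \<open>S\<close> might have fewer than two elements, but
      then \<open>A \<le> 4 * \<Lambda>\<close> and a single vertex suffices.\<close>
    case True
    have "A ^ 3 \<le> (4 * \<Lambda>) ^ 3"
    proof -
      have "64 * \<Lambda>\<^sup>2 * 1 \<le> 64 * \<Lambda>\<^sup>2 * \<Lambda>" using \<Lambda>1 by (intro mult_left_mono) auto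
      then show ?thesis unfolding A3 using True by (simp add: power2_eq_square power3_eq_cube)
    qed
    then have "A \<le> 4 * \<Lambda>" using power_mono_iff[of A "4 * \<Lambda>" 3] A1 \<Lambda>1 by simp
    then have "A * B\<^sup>2 \<le> 4 * \<Lambda> * B\<^sup>2" by (intro mult_right_mono) auto
    then have "A * B\<^sup>2 / (128 * \<Lambda>) \<le> B\<^sup>2 / 32" using \<Lambda>1 by (simp add: field_simps)
    also have "\<dots> \<le> minimax_regret K E T"
      using single_vertex_lower_bound[OF weak K(1) KT(1)] by (simp add: B_def)
    finally show ?thesis .
  next
    case False
    have \<Lambda>2: "\<Lambda> * 1 \<le> \<Lambda>\<^sup>2" unfolding power2_eq_square using \<Lambda>1 by (intro mult_left_mono) auto
    \<comment> \<open>Up to constants the largest \<open>r\<close> with \<open>4 * r \<le> n\<close>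
      and \<open>2 * \<Lambda> * r \<le> n\<close>; rounding down costs at most a factor 2 because
      the quotient is at least 2.\<close>
    define r where "r = nat \<lfloor>\<delta> / (4 * \<Lambda>)\<rfloor>"
    have quot: "0 \<le> \<delta> / (4 * \<Lambda>)" using \<delta> \<Lambda>1 by simp
    have r_le: "real r \<le> \<delta> / (4 * \<Lambda>)" using quot by (simp add: r_def)
    have "2 \<le> \<delta> / (4 * \<Lambda>)" using False \<Lambda>1 \<Lambda>2 by (simp add: field_simps)
    then have r_ge: "\<delta> / (8 * \<Lambda>) \<le> real r"
    proof -
      have "\<delta> / (4 * \<Lambda>) - 1 \<le> real r" using quot by (simp add: r_def)
      moreover have "\<delta> / (8 * \<Lambda>) = \<delta> / (4 * \<Lambda>) / 2" by simp
      ultimately show ?thesis using \<open>2 \<le> \<delta> / (4 * \<Lambda>)\<close> by linarith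
    qed
    have "4 * \<Lambda> * r \<le> \<delta>" using r_le \<Lambda>1 by (simp add: field_simps)
    moreover have "1 * real r \<le> \<Lambda> * r" using \<Lambda>1 by (intro mult_right_mono) auto
    ultimately have "4 * real r \<le> \<delta>" "2 * \<Lambda> * r \<le> \<delta>" by auto
    then have r_bounds: "4 * r \<le> n" "2 * \<Lambda> * r \<le> n" by (auto simp: \<delta>_def)
    have "4 \<le> n" using False \<Lambda>1 \<Lambda>2 by (simp add: \<delta>_def)
    then obtain S where S: "S \<subseteq> weak_vertices K E" "independent_set E S" "r \<le> (8 * \<Lambda>) * card S"
      "\<And>v. v < K \<Longrightarrow> card {w\<in>S. (v, w) \<in> E} \<le> 3 * \<Lambda>"
      using exists_thinly_dominated_independent_set[of K \<Lambda> E r] K(1) \<Lambda>1 ln\<Lambda> r_bounds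
      unfolding n_def by auto
    have S_ge: "\<delta> / (64 * \<Lambda>\<^sup>2) \<le> card S"
    proof -
      have "\<delta> / (8 * \<Lambda>) \<le> (8 * \<Lambda>) * card S" using r_ge S(3) by linarith
      then show ?thesis using \<Lambda>1 by (simp add: field_simps power2_eq_square)
    qed
    have "1 < \<delta> / (64 * \<Lambda>\<^sup>2)" using False \<Lambda>1 by (simp add: field_simps)
    then have card2: "2 \<le> card S" using S_ge by linarith
    define c where "c = card S / (3 * \<Lambda> * T)"
    define Y where "Y = c powr (1/3)"
    have "0 < c" using card2 \<Lambda>1 KT by (simp add: c_def)
    then have Y: "Y ^ 3 = card S / (3 * \<Lambda> * T)" "0 < Y"
      by (simp_all add: Y_def powr_third_cube c_def[symmetric])
    have "Y * T / 16 \<le> minimax_regret K E T"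
      using S(4) \<Lambda>1 by (intro independent_set_lower_bound[OF K(1) KT(1) S(1,2) card2 _ _ Y]) auto
    moreover have "A * B\<^sup>2 / (128 * \<Lambda>) \<le> Y * T / 16"
    proof -
      have "(A / (6 * \<Lambda> * B)) ^ 3 = \<delta> / (216 * \<Lambda> ^ 3 * T)"
        by (simp add: power_divide power_mult_distrib A3 B3)
      also have "\<dots> \<le> \<delta> / (192 * \<Lambda> ^ 3 * T)"
        using \<delta> \<Lambda>1 KT by (intro divide_left_mono mult_right_mono) auto
      also have "\<dots> = \<delta> / (64 * \<Lambda>\<^sup>2) / (3 * \<Lambda> * T)"
        by (simp add: power2_eq_square power3_eq_cube)
      also have "\<dots> \<le> Y ^ 3"
        unfolding Y(1) using S_ge \<Lambda>1 by (intro divide_right_mono) auto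
      finally have "A / (6 * \<Lambda> * B) \<le> Y"
        using power_mono_iff[of "A / (6 * \<Lambda> * B)" Y 3] A1 \<Lambda>1 Y(2) by simp
      then have "A / (6 * \<Lambda> * B) * T \<le> Y * T" by (intro mult_right_mono) auto
      moreover have "A / (6 * \<Lambda> * B) * T = A * B\<^sup>2 / (6 * \<Lambda>)"
        using B3[symmetric] A1 by (simp add: power2_eq_square power3_eq_cube)
      moreover have "A * B\<^sup>2 / (128 * \<Lambda>) \<le> A * B\<^sup>2 / (6 * \<Lambda>) / 16"
        using A1 \<Lambda>1 by (simp add: field_simps)
      ultimately show ?thesis by simp
    qed
    ultimately show ?thesis by simp
  qed
  then show ?thesis by (simp add: A_def B_def \<delta>_def n_def \<Lambda>_def powr_two_thirds)
qed

theorem theorem1: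
  shows "\<exists>(c::real) (C::real) (p::nat). 0 < c \<and> 0 < C \<and>
    (\<forall>(K::nat) (E::(nat \<times> nat) set) (T::nat).
       2 \<le> K \<longrightarrow> E \<subseteq> {..<K} \<times> {..<K} \<longrightarrow> K ^ 3 \<le> T \<longrightarrow>
       (let R = minimax_regret K E T;
            L = (1 + ln (real K * real T)) ^ p;
            \<alpha> = real (independence_number K E);
            \<delta> = real (weak_domination_number K E)
        in (strongly_observable_graph K E \<longrightarrow>
              c * sqrt \<alpha> * sqrt (real T) / L \<le> R \<and> R \<le> C * sqrt \<alpha> * sqrt (real T) * L)
         \<and> (weakly_observable_graph K E \<longrightarrow>
              c * \<delta> powr (1/3) * real T powr (2/3) / L \<le> R \<and>
              R \<le> C * \<delta> powr (1/3) * real T powr (2/3) * L)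
         \<and> (\<not> observable_graph K E \<longrightarrow>
              c * real T \<le> R \<and> R \<le> C * real T)))"
proof (rule exI[of _ "1/128"], rule exI[of _ 13], rule exI[of _ 1], intro conjI allI impI)
  \<comment> \<open>\<open>1/128\<close> comes from the weakly observable lower bound, 13 from the
    strongly observable upper bound; the other cases have better constants.\<close>
  fix K :: nat and E :: "(nat \<times> nat) set" and T :: nat
  assume K: "2 \<le> K" "K ^ 3 \<le> T" and E: "E \<subseteq> {..<K} \<times> {..<K}"
  define \<alpha> where "\<alpha> = real (independence_number K E)"
  define \<delta> where "\<delta> = real (weak_domination_number K E)"
  define L where "L = 1 + ln (real K * real T)"
  define R where "R = minimax_regret K E T"
  have "1 \<le> K ^ 3" using K(1) by simp
  then have "1 \<le> T" using K(2) by (rule order.trans)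
  then have "1 \<le> real K * real T" using K mult_mono[of 1 "real K" 1 "real T"] by simp
  then have L: "1 \<le> L" by (simp add: L_def)
  have "1/128 * sqrt \<alpha> * sqrt T / L \<le> R" "R \<le> 13 * sqrt \<alpha> * sqrt T * L"
    if "strongly_observable_graph K E"
  proof -
    have "1/128 * sqrt \<alpha> * sqrt T / L \<le> sqrt \<alpha> * sqrt T / 64 / 1"
      using L by (intro frac_le) (auto simp: \<alpha>_def)
    also have "\<dots> \<le> R"
      using minimax_regret_strongly_observable_ge[OF K, of E] by (simp add: \<alpha>_def R_def)
    finally show "1/128 * sqrt \<alpha> * sqrt T / L \<le> R" .
    show "R \<le> 13 * sqrt \<alpha> * sqrt T * L"
      using minimax_regret_strongly_observable_le[OF K that] by (simp add: \<alpha>_def R_def L_def)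
  qed
  moreover have "1/128 * \<delta> powr (1/3) * T powr (2/3) / L \<le> R"
    "R \<le> 13 * \<delta> powr (1/3) * T powr (2/3) * L" if "weakly_observable_graph K E"
  proof -
    show "1/128 * \<delta> powr (1/3) * T powr (2/3) / L \<le> R"
      using minimax_regret_weakly_observable_ge[OF K that] by (simp add: \<delta>_def R_def L_def)
    have "R \<le> 10 * \<delta> powr (1/3) * T powr (2/3) * L"
      using minimax_regret_weakly_observable_le[OF K that] by (simp add: \<delta>_def R_def L_def)
    also have "\<dots> \<le> 13 * \<delta> powr (1/3) * T powr (2/3) * L"
      using L by (intro mult_right_mono) auto
    finally show "R \<le> 13 * \<delta> powr (1/3) * T powr (2/3) * L" .
  qed
  moreover have "1/128 * real T \<le> R" "R \<le> 13 * real T" if "\<not> observable_graph K E"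
    using minimax_regret_not_observable[OF K(1) E that, of T] minimax_regret_le_T[of K E T] K(1)
    by (auto simp: R_def)
  ultimately show "let R = minimax_regret K E T;
            L = (1 + ln (real K * real T)) ^ 1;
            \<alpha> = real (independence_number K E);
            \<delta> = real (weak_domination_number K E)
        in (strongly_observable_graph K E \<longrightarrow>
              1/128 * sqrt \<alpha> * sqrt (real T) / L \<le> R \<and> R \<le> 13 * sqrt \<alpha> * sqrt (real T) * L)
         \<and> (weakly_observable_graph K E \<longrightarrow>
              1/128 * \<delta> powr (1/3) * real T powr (2/3) / L \<le> R \<and>
              R \<le> 13 * \<delta> powr (1/3) * real T powr (2/3) * L)
         \<and> (\<not> observable_graph K E \<longrightarrow>
              1/128 * real T \<le> R \<and> R \<le> 13 * real T)"
    unfolding Let_def power_one_right R_def[symmetric] L_def[symmetric] \<alpha>_def[symmetric] \<delta>_def[symmetric]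
    by blast
qed auto

end
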